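(* Let $\alpha=(\alpha_1,\alpha_2,\alpha_3)$ be real numbers with $\alpha_1+\alpha_2+\alpha_3=0$, $\alpha_1\in\,]0,1[$, $\alpha_2,\alpha_3\in\,]-1,0[$. Let $a\in\mathbb R^2$ and assume that $\mathscr F^\alpha_a\subset\mathscr M_{1,3}$ is an algebraic leaf of Veech's foliation $\mathscr F^\alpha$. Let $S_a$ be the image in $\mathrm{SL}_2(\mathbb Z)$ of the stabilizer of $a$ in $\mathrm{SL}_2(\mathbb Z)\ltimes(\mathbb Z^2)^2$. 1. There exists an integer $N_a$ such that $S_a\simeq\Gamma_1(N_a)$. 2. The leaf $\mathscr F^\alpha_a$ is isomorphic to the total space of the elliptic modular surface $\mathscr E_1(N_a)\to Y_1(N_a)$ from which the union of a finite number of torsion multi-sections has been removed.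
   Context: For $\tau\in\mathbb H$ write $\mathbb Z_\tau=\mathbb Z+\mathbb Z\tau$. The Torelli space is $\mathcal T\!or_{1,3}=\{(\tau,z_2,z_3)\in\mathbb H\times\mathbb C^2:z_2,\,z_3,\,z_2-z_3\notin\mathbb Z_\tau\}$. The group $\mathrm{SL}_2(\mathbb Z)\ltimes(\mathbb Z^2)^2$ acts on it by $\big(\begin{bmatrix} p & q \\ r & s \end{bmatrix},(k_i,l_i)_{i=2,3}\big)\cdot(\tau,z_2,z_3)=\big(\frac{p\tau+q}{r\tau+s},\frac{z_2+k_2+l_2\tau}{r\tau+s},\frac{z_3+k_3+l_3\tau}{r\tau+s}\big)$ and the quotient is the moduli space $\mathscr M_{1,3}$ of 3-marked elliptic curves. The leaves of Veech's foliation on $\mathcal T\!or_{1,3}$ are $\mathcal F^\alpha_a=\{a_0\tau+\alpha_2z_2+\alpha_3z_3=a_\infty\}$, $a=(a_0,a_\infty)\in\mathbb R^2$, and $\mathscr F^\alpha_a$ is the image of $\mathcal F^\alpha_a$ in $\mathscr M_{1,3}$; it is called algebraic if it is an algebraic subvariety of $\mathscr M_{1,3}$. The group acts on $\mathbb R^2$ by $$\Big(\begin{bmatrix} p & q \\ r & s \end{bmatrix},(k_i,l_i)_{i=2,3}\Big)\bullet(a_0,a_\infty)=\Big(a_0p-a_\infty r+\sum_{i=2}^3\alpha_il_i,\ -a_0q+a_\infty s-\sum_{i=2}^3\alpha_ik_i\Big),$$ so that $g^{-1}(\mathcal F^\alpha_a)=\mathcal F^\alpha_{g\bullet a}$; "stabilizer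 of $a$" refers to this action. $\Gamma_1(N)$ is the group of matrices $\begin{bmatrix} p & q \\ r & s \end{bmatrix}\in\mathrm{SL}_2(\mathbb Z)$ with $p\equiv s\equiv1$, $r\equiv0$ mod $N$; $Y_1(N)=\mathbb H/\Gamma_1(N)$. The elliptic modular surface $\mathscr E_1(N)\to Y_1(N)$ is the quotient of $\mathbb H\times\mathbb C$ by $\Gamma_1(N)\ltimes\mathbb Z^2$ acting by $(\tau,\xi)\mapsto\big(\frac{p\tau+q}{r\tau+s},\frac{\xi+k+l\tau}{r\tau+s}\big)$. A torsion multi-section is an irreducible curve in $\mathscr E_1(N)$ that is the image of a set $\{(\tau,x+y\tau):\tau\in\mathbb H\}$ with $(x,y)\in\mathbb Q^2$. *)

theory Defs
  imports
    "HOL-Analysis.Analysis"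
    "HOL-Algebra.Group"
    "HOL-Number_Theory.Cong"
begin

section \<open>Reduced complex spaces as spaces with functions\<close>

text \<open>
  Possibly singular reduced complex analytic spaces are handled as topological spaces with a sheaf
  of complex-valued functions: \<open>regular X U f\<close> says that \<open>f\<close>, of which only the values on the open
  set \<open>U\<close> matter, is a section over \<open>U\<close> of the structure sheaf.
\<close>

record 'a cspace =
  underlying :: "'a topology"
  regular :: "'a set \<Rightarrow> ('a \<Rightarrow> complex) \<Rightarrow> bool"

definition cspace_iso :: "'a cspace \<Rightarrow> 'b cspace \<Rightarrow> ('a \<Rightarrow> 'b) \<Rightarrow> bool" where
  "cspace_iso X Y \<phi> \<longleftrightarrow>
     homeomorphic_map (underlying X) (underlying Y) \<phi> \<and>
     (\<forall>V f. openin (underlying Y) V \<longrightarrow>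
        (regular Y V f \<longleftrightarrow>
         regular X {x \<in> topspace (underlying X). \<phi> x \<in> V} (\<lambda>x. f (\<phi> x))))"

definition cspace_isomorphic :: "'a cspace \<Rightarrow> 'b cspace \<Rightarrow> bool" where
  "cspace_isomorphic X Y \<longleftrightarrow> (\<exists>\<phi>. cspace_iso X Y \<phi>)"

text \<open>
  The induced reduced structure on a subset: functions that are locally restrictions of regular
  functions of the ambient space. For an open subset this is the restriction of the sheaf.
\<close>

definition subcspace :: "'a cspace \<Rightarrow> 'a set \<Rightarrow> 'a cspace" where
  "subcspace X A = \<lparr>
     underlying = subtopology (underlying X) A,
     regular = (\<lambda>V f. \<forall>p\<in>V. \<exists>W F. openin (underlying X) W \<and> p \<in> W \<and> regular X W F \<and>
                                    (\<forall>q \<in> W \<inter> V. F q = f q)) \<rparr>"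

text \<open>
  Holomorphy in several variables: real Frechet differentiability with a complex-linear derivative.
  The argument \<open>sc\<close> is the scalar multiplication by complex numbers on the ambient vector space.
\<close>

definition holomorphic_wrt ::
  "(complex \<Rightarrow> 'a \<Rightarrow> 'a) \<Rightarrow> 'a set \<Rightarrow> ('a::real_normed_vector \<Rightarrow> complex) \<Rightarrow> bool" where
  "holomorphic_wrt sc U f \<longleftrightarrow>
     (\<forall>x\<in>U. \<exists>D. (f has_derivative D) (at x) \<and> (\<forall>c v. D (sc c v) = c * D v))"

fun scale2 :: "complex \<Rightarrow> complex \<times> complex \<Rightarrow> complex \<times> complex" where
  "scale2 c (u, v) = (c * u, c * v)"

fun scale3 :: "complex \<Rightarrow> complex \<times> complex \<times> complex \<Rightarrow> complex \<times> complex \<times> complex" where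
  "scale3 c (u, v, w) = (c * u, c * v, c * w)"

definition quotient_topology :: "'a topology \<Rightarrow> ('a \<Rightarrow> 'b) \<Rightarrow> 'b topology" where
  "quotient_topology X f =
     topology (\<lambda>U. U \<subseteq> f ` topspace X \<and> openin X {x \<in> topspace X. f x \<in> U})"

lemma openin_quotient_topology:
  "openin (quotient_topology X f) U \<longleftrightarrow>
     U \<subseteq> f ` topspace X \<and> openin X {x \<in> topspace X. f x \<in> U}"
proof -
  have "istopology (\<lambda>U. U \<subseteq> f ` topspace X \<and> openin X {x \<in> topspace X. f x \<in> U})"
    unfolding istopology_def
  proof (intro conjI allI impI)
    fix S T
    assume S: "S \<subseteq> f ` topspace X \<and> openin X {x \<in> topspace X. f x \<in> S}"
      and T: "T \<subseteq> f ` topspace X \<and> openin X {x \<in> topspace X. f x \<in> T}"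
    have eq: "{x \<in> topspace X. f x \<in> S \<inter> T} =
        {x \<in> topspace X. f x \<in> S} \<inter> {x \<in> topspace X. f x \<in> T}" by auto
    show "S \<inter> T \<subseteq> f ` topspace X" using S by blast
    show "openin X {x \<in> topspace X. f x \<in> S \<inter> T}"
      unfolding eq using S T by (intro openin_Int) simp_all
  next
    fix \<K>
    assume K: "\<forall>K\<in>\<K>. K \<subseteq> f ` topspace X \<and> openin X {x \<in> topspace X. f x \<in> K}"
    then show "\<Union>\<K> \<subseteq> f ` topspace X" by blast
    have "openin X (\<Union>K\<in>\<K>. {x \<in> topspace X. f x \<in> K})"
      using K by (intro openin_Union) blast
    moreover have "(\<Union>K\<in>\<K>. {x \<in> topspace X. f x \<in> K}) = {x \<in> topspace X. f x \<in> \<Union>\<K>}"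
      by blast
    ultimately show "openin X {x \<in> topspace X. f x \<in> \<Union>\<K>}" by (simp only:)
  qed
  then show ?thesis
    unfolding quotient_topology_def by (subst topology_inverse') (assumption, rule refl)
qed

lemma topspace_quotient_topology [simp]:
  "topspace (quotient_topology X f) = f ` topspace X"
proof
  have "openin (quotient_topology X f) (topspace (quotient_topology X f))"
    by (rule openin_topspace)
  then show "topspace (quotient_topology X f) \<subseteq> f ` topspace X"
    unfolding openin_quotient_topology by (rule conjunct1)
  have "{x \<in> topspace X. f x \<in> f ` topspace X} = topspace X" by auto
  then have "openin (quotient_topology X f) (f ` topspace X)"
    unfolding openin_quotient_topology by simp
  then show "f ` topspace X \<subseteq> topspace (quotient_topology X f)"
    by (rule openin_subset)
qed

lemma quotient_map_quotient_topology: "quotient_map X (quotient_topology X f) f"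
  unfolding quotient_map_def topspace_quotient_topology openin_quotient_topology by simp

definition orbit :: "('g \<Rightarrow> 'a \<Rightarrow> 'a) \<Rightarrow> 'g set \<Rightarrow> 'a \<Rightarrow> 'a set" where
  "orbit act G x = (\<lambda>g. act g x) ` G"

text \<open>
  The quotient of an open set \<open>D\<close> by the action of \<open>G\<close>; its points are the orbits, and regular
  functions are those whose pullback to \<open>D\<close> is holomorphic.
\<close>

definition quotient_cspace ::
  "(complex \<Rightarrow> 'a \<Rightarrow> 'a) \<Rightarrow> 'a::real_normed_vector set \<Rightarrow> ('g \<Rightarrow> 'a \<Rightarrow> 'a) \<Rightarrow> 'g set \<Rightarrow> 'a set cspace"
  where
  "quotient_cspace sc D act G = \<lparr>
     underlying = quotient_topology (top_of_set D) (orbit act G),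
     regular = (\<lambda>U f. holomorphic_wrt sc {x \<in> D. orbit act G x \<in> U} (\<lambda>x. f (orbit act G x))) \<rparr>"


section \<open>Modular groups\<close>

definition SL2Z :: "(int^2^2) monoid" where
  "SL2Z = \<lparr> carrier = {A. det A = 1}, monoid.mult = (**), one = mat 1 \<rparr>"

definition Gamma1 :: "nat \<Rightarrow> (int^2^2) set" where
  "Gamma1 N = {A \<in> carrier SL2Z.
     [A$1$1 = 1] (mod int N) \<and> [A$2$2 = 1] (mod int N) \<and> [A$2$1 = 0] (mod int N)}"


section \<open>The Torelli space and the moduli space\<close>

definition period_lattice :: "complex \<Rightarrow> complex set" where
  "period_lattice \<tau> = {of_int m + of_int n * \<tau> | m n. True}"

definition Torelli :: "(complex \<times> complex \<times> complex) set" where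
  "Torelli = {(\<tau>, z2, z3). Im \<tau> > 0 \<and> z2 \<notin> period_lattice \<tau> \<and> z3 \<notin> period_lattice \<tau> \<and>
                            z2 - z3 \<notin> period_lattice \<tau>}"

text \<open>An element of the semidirect product is written \<open>(A, k2, l2, k3, l3)\<close>.\<close>

type_synonym torelli_elt = "(int^2^2) \<times> int \<times> int \<times> int \<times> int"

definition torelli_group :: "torelli_elt set" where
  "torelli_group = carrier SL2Z \<times> UNIV"

fun torelli_act ::
  "torelli_elt \<Rightarrow> complex \<times> complex \<times> complex \<Rightarrow> complex \<times> complex \<times> complex" where
  "torelli_act (A, k2, l2, k3, l3) (\<tau>, z2, z3) =
     (let j = of_int (A$2$1) * \<tau> + of_int (A$2$2) in
       ((of_int (A$1$1) * \<tau> + of_int (A$1$2)) / j,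
        (z2 + of_int k2 + of_int l2 * \<tau>) / j,
        (z3 + of_int k3 + of_int l3 * \<tau>) / j))"

definition M13 :: "(complex \<times> complex \<times> complex) set cspace" where
  "M13 = quotient_cspace scale3 Torelli torelli_act torelli_group"

definition to_M13 :: "complex \<times> complex \<times> complex \<Rightarrow> (complex \<times> complex \<times> complex) set" where
  "to_M13 = orbit torelli_act torelli_group"


section \<open>Algebraic subvarieties of the moduli space\<close>

definition weierstrass_g2 :: "complex \<Rightarrow> complex" where
  "weierstrass_g2 \<tau> = 60 * (\<Sum>\<^sub>\<infinity>w\<in>period_lattice \<tau> - {0}. 1 / w ^ 4)"

definition weierstrass_g3 :: "complex \<Rightarrow> complex" where
  "weierstrass_g3 \<tau> = 140 * (\<Sum>\<^sub>\<infinity>w\<in>period_lattice \<tau> - {0}. 1 / w ^ 6)"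

definition weierstrass_p :: "complex \<Rightarrow> complex \<Rightarrow> complex" where
  "weierstrass_p \<tau> z =
     1 / z ^ 2 + (\<Sum>\<^sub>\<infinity>w\<in>period_lattice \<tau> - {0}. 1 / (z - w) ^ 2 - 1 / w ^ 2)"

definition weierstrass_p' :: "complex \<Rightarrow> complex \<Rightarrow> complex" where
  "weierstrass_p' \<tau> z = - 2 * (\<Sum>\<^sub>\<infinity>w\<in>period_lattice \<tau>. 1 / (z - w) ^ 3)"

text \<open>
  A 3-marked elliptic curve is a plane cubic \<open>y^2 = 4 x^3 - g2 x - g3\<close> with its point at infinity
  and two further distinct points \<open>(x2, y2)\<close>, \<open>(x3, y3)\<close>, up to the rescalings
  \<open>(g2, g3, x2, y2, x3, y3) \<mapsto> (t^4 g2, t^6 g3, t^2 x2, t^3 y2, t^2 x3, t^3 y3)\<close>. This realises the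
  moduli space as a locally closed subvariety of the weighted projective space with weights
  \<open>(4, 6, 2, 3, 2, 3)\<close>, which gives it its structure of algebraic variety.
\<close>

fun weierstrass_coords :: "complex \<times> complex \<times> complex \<Rightarrow> complex list" where
  "weierstrass_coords (\<tau>, z2, z3) =
     [weierstrass_g2 \<tau>, weierstrass_g3 \<tau>,
      weierstrass_p \<tau> z2, weierstrass_p' \<tau> z2,
      weierstrass_p \<tau> z3, weierstrass_p' \<tau> z3]"

definition M13_weights :: "nat list" where
  "M13_weights = [4, 6, 2, 3, 2, 3]"

text \<open>\<open>E\<close> is the set of exponent vectors of the monomials that occur, \<open>c\<close> gives the coefficients.\<close>

definition weighted_homogeneous_poly :: "nat list \<Rightarrow> nat \<Rightarrow> (complex list \<Rightarrow> complex) \<Rightarrow> bool" where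
  "weighted_homogeneous_poly ws d P \<longleftrightarrow>
     (\<exists>(E :: (nat \<Rightarrow> nat) set) (c :: (nat \<Rightarrow> nat) \<Rightarrow> complex). finite E \<and>
        (\<forall>e\<in>E. (\<Sum>i<length ws. ws ! i * e i) = d) \<and>
        (\<forall>x. length x = length ws \<longrightarrow>
             P x = (\<Sum>e\<in>E. c e * (\<Prod>i<length ws. (x ! i) ^ e i))))"

text \<open>
  Zariski closed subsets. Irreducibility is not required: it is automatic for the leaves considered
  below, which are images of connected complex manifolds.
\<close>

definition algebraic_in_M13 :: "(complex \<times> complex \<times> complex) set set \<Rightarrow> bool" where
  "algebraic_in_M13 V \<longleftrightarrow>
     (\<exists>\<P>. (\<forall>P\<in>\<P>. \<exists>d. weighted_homogeneous_poly M13_weights d P) \<and>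
          V = to_M13 ` {x \<in> Torelli. \<forall>P\<in>\<P>. P (weierstrass_coords x) = 0})"


section \<open>Veech's foliation\<close>

fun torelli_leaf :: "real \<Rightarrow> real \<Rightarrow> real \<times> real \<Rightarrow> (complex \<times> complex \<times> complex) set" where
  "torelli_leaf \<alpha>2 \<alpha>3 (a0, ainf) =
     {(\<tau>, z2, z3). (\<tau>, z2, z3) \<in> Torelli \<and>
        of_real a0 * \<tau> + of_real \<alpha>2 * z2 + of_real \<alpha>3 * z3 = of_real ainf}"

definition M13_leaf :: "real \<Rightarrow> real \<Rightarrow> real \<times> real \<Rightarrow> (complex \<times> complex \<times> complex) set set" where
  "M13_leaf \<alpha>2 \<alpha>3 a = to_M13 ` torelli_leaf \<alpha>2 \<alpha>3 a"

fun leaf_act :: "real \<Rightarrow> real \<Rightarrow> torelli_elt \<Rightarrow> real \<times> real \<Rightarrow> real \<times> real" where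
  "leaf_act \<alpha>2 \<alpha>3 (A, k2, l2, k3, l3) (a0, ainf) =
     (a0 * of_int (A$1$1) - ainf * of_int (A$2$1) + (\<alpha>2 * of_int l2 + \<alpha>3 * of_int l3),
      - a0 * of_int (A$1$2) + ainf * of_int (A$2$2) - (\<alpha>2 * of_int k2 + \<alpha>3 * of_int k3))"

definition leaf_stabilizer :: "real \<Rightarrow> real \<Rightarrow> real \<times> real \<Rightarrow> torelli_elt set" where
  "leaf_stabilizer \<alpha>2 \<alpha>3 a = {g \<in> torelli_group. leaf_act \<alpha>2 \<alpha>3 g a = a}"

definition S_group :: "real \<Rightarrow> real \<Rightarrow> real \<times> real \<Rightarrow> (int^2^2) set" where
  "S_group \<alpha>2 \<alpha>3 a = fst ` leaf_stabilizer \<alpha>2 \<alpha>3 a"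


section \<open>Elliptic modular surfaces\<close>

type_synonym jacobi_elt = "(int^2^2) \<times> int \<times> int"

definition jacobi_group :: "nat \<Rightarrow> jacobi_elt set" where
  "jacobi_group N = Gamma1 N \<times> UNIV"

fun jacobi_act :: "jacobi_elt \<Rightarrow> complex \<times> complex \<Rightarrow> complex \<times> complex" where
  "jacobi_act (A, k, l) (\<tau>, \<xi>) =
     (let j = of_int (A$2$1) * \<tau> + of_int (A$2$2) in
       ((of_int (A$1$1) * \<tau> + of_int (A$1$2)) / j,
        (\<xi> + of_int k + of_int l * \<tau>) / j))"

definition elliptic_modular_surface :: "nat \<Rightarrow> (complex \<times> complex) set cspace" where
  "elliptic_modular_surface N =
     quotient_cspace scale2 {(\<tau>, \<xi>). Im \<tau> > 0} jacobi_act (jacobi_group N)"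

text \<open>
  These images are automatically irreducible curves, being closed images of a half-plane.
\<close>

definition torsion_multisection :: "nat \<Rightarrow> (complex \<times> complex) set set \<Rightarrow> bool" where
  "torsion_multisection N C \<longleftrightarrow>
     (\<exists>x y :: rat. C = orbit jacobi_act (jacobi_group N) `
                        {(\<tau>, of_rat x + of_rat y * \<tau>) | \<tau>. Im \<tau> > 0})"

end

theory Submission
  imports Defs
begin

text \<open>
  An algebraic leaf has a closed preimage in the Torelli space, so the countable orbit of \<open>a\<close> is
  closed in the plane. By Kronecker's theorem a closed countable subset of the line cannot contain the
  integer combinations of two incommensurable numbers, so \<open>\<alpha>2\<close>, \<open>\<alpha>3\<close> and the entries of \<open>a\<close> are
  commensurable. An element of the modular group then moves the leaf to
  \<open>m2 z2 + m3 z3 = d / N\<close> with \<open>m2\<close>, \<open>m3\<close> and \<open>d\<close>, \<open>N\<close> coprime, whose stabilizer is the Jacobi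
  group of level \<open>N\<close>. In the unimodular coordinates \<open>\<xi> = c3 z2 - c2 z3\<close> and \<open>m2 z2 + m3 z3\<close> the
  projection \<open>(\<tau>, z2, z3) \<mapsto> (\<tau>, \<xi>)\<close> is equivariant, hence induces a holomorphic retraction of a
  neighbourhood of the leaf in the moduli space onto an open part of the modular surface.
\<close>

section \<open>The Weierstrass functions of the Gaussian lattice\<close>

text \<open>Algebraicity enters through continuity alone, on the fibre over \<i>: hence convergence
  is established for the Gaussian lattice, while the modular transformation laws are formal
  reindexings that hold for every \<tau> and carry the vanishing of a polynomial along an orbit. The
  obstacle on the analytic side is that both the topology and the sheaf of the leaf are induced from
  the moduli space. A holomorphic parametrization of the leaf does not suffice: a function on the
  leaf must extend to an ambient neighbourhood, and the leaf must not accumulate on itself. This is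
  why a tube around the leaf is needed in which every identification comes from the stabilizer.
  Points with nontrivial isotropy need no special treatment, since regularity is always tested on
  the covering spaces. The level N is the denominator, in lowest terms, of the one rational number
  left after the parameter row has been reduced by the modular group.\<close>

lemma compact_series_continuous:
  fixes f :: "'a \<Rightarrow> complex \<Rightarrow> complex"
  assumes K: "compact K" and cont: "\<And>w. w \<in> A \<Longrightarrow> continuous_on K (f w)"
    and fin: "finite F" and M: "M summable_on A"
    and le: "\<And>w z. w \<in> A - F \<Longrightarrow> z \<in> K \<Longrightarrow> norm (f w z) \<le> M w"
  shows "\<And>z. z \<in> K \<Longrightarrow> (\<lambda>w. f w z) summable_on A"
    and "continuous_on K (\<lambda>z. \<Sum>\<^sub>\<infinity>w\<in>A. f w z)"
proof -
  have "\<exists>B. \<forall>z\<in>K. norm (f w z) \<le> B" if "w \<in> A" for w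
    using compact_imp_bounded[OF compact_continuous_image[OF cont[OF that] K]]
    unfolding bounded_iff by auto
  then obtain B where B: "\<And>w z. w \<in> A \<Longrightarrow> z \<in> K \<Longrightarrow> norm (f w z) \<le> B w" by metis
  \<comment> \<open>On the finite exceptional set the majorant is the bound \<open>B\<close> that
    compactness of \<open>K\<close> provides.\<close>
  define M' where "M' w = (if w \<in> F then B w else M w)" for w
  have "M' summable_on (A - F)"
    using summable_on_subset_banach[OF M, of "A - F"]
    by (rule summable_on_cong[THEN iffD1, rotated]) (auto simp: M'_def)
  moreover have "M' summable_on (A \<inter> F)" using fin by (intro summable_on_finite) auto
  ultimately have M': "M' summable_on A"
    using summable_on_union[of M' "A - F" "A \<inter> F"] by (simp add: Un_Diff_Int)
  have le': "norm (f w z) \<le> M' w" if "w \<in> A" "z \<in> K" for w z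
    using that le B by (auto simp: M'_def)
  show "(\<lambda>w. f w z) summable_on A" if "z \<in> K" for z
    by (rule abs_summable_summable, rule Infinite_Sum.abs_summable_on_comparison_test'[OF M'])
      (use le' that in auto)
  have "uniform_limit K (\<lambda>X z. \<Sum>w\<in>X. f w z) (\<lambda>z. \<Sum>\<^sub>\<infinity>w\<in>A. f w z) (finite_subsets_at_top A)"
    by (rule Weierstrass_m_test_general[OF le' M'])
  then show "continuous_on K (\<lambda>z. \<Sum>\<^sub>\<infinity>w\<in>A. f w z)"
    by (rule uniform_limit_theorem[rotated])
       (auto intro!: eventually_finite_subsets_at_top_weakI continuous_on_sum cont)
qed

lemma summable_on_int_powr: "(\<lambda>n::int. max 1 \<bar>real_of_int n\<bar> powr (-3/2)) summable_on UNIV"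
proof -
  let ?f = "\<lambda>n::int. max 1 \<bar>real_of_int n\<bar> powr (-3/2)"
  have "summable (\<lambda>n. real n powr (-3/2))" by (simp add: summable_real_powr_iff)
  then have "summable (\<lambda>n. real (Suc n) powr (-3/2))" by (subst summable_Suc_iff)
  then have s: "(\<lambda>n. real (Suc n) powr (-3/2)) summable_on UNIV"
    by (subst summable_on_UNIV_nonneg_real_iff) auto
  have 1: "?f summable_on ((\<lambda>n::nat. int (Suc n)) ` UNIV)"
    by (subst summable_on_reindex) (use s in \<open>auto simp: o_def inj_on_def max_def\<close>)
  have 2: "?f summable_on ((\<lambda>n::nat. - int (Suc n)) ` UNIV)"
    by (subst summable_on_reindex) (use s in \<open>auto simp: o_def inj_on_def max_def algebra_simps\<close>)
  have 3: "?f summable_on {0}" by simp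
  have "?f summable_on ((range (\<lambda>n::nat. int (Suc n)) \<union> range (\<lambda>n::nat. - int (Suc n))) \<union> {0})"
    by (intro summable_on_union 1 2 3)
  moreover have "(range (\<lambda>n::nat. int (Suc n)) \<union> range (\<lambda>n::nat. - int (Suc n))) \<union> {0} = UNIV"
  proof (rule UNIV_eq_I[symmetric])
    fix n :: int
    show "n \<in> (range (\<lambda>n::nat. int (Suc n)) \<union> range (\<lambda>n::nat. - int (Suc n))) \<union> {0}"
    proof (cases n rule: int_cases3)
      case (pos k) then show ?thesis by (auto intro!: image_eqI[of _ _ "k - 1"])
    next
      case (neg k) then show ?thesis by (auto intro!: image_eqI[of _ _ "k - 1"])
    qed simp
  qed
  ultimately show ?thesis by (simp only:)
qed

lemma period_lattice_image:
  "period_lattice \<tau> = (\<lambda>(m, n). of_int m + of_int n * \<tau>) ` UNIV"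
  by (auto simp: period_lattice_def)

text \<open>If both entries are nonzero this is the inequality of arithmetic and geometric means. On
  the axes the maximum with 1 replaces the vanishing entry, and what remains is |k| \<le> k^2 for
  integers. The bound is a product, so that the double sum splits.\<close>

lemma gaussian_norm_bound:
  assumes "(m, n) \<noteq> (0, 0)"
  shows "max 1 \<bar>real_of_int m\<bar> * max 1 \<bar>real_of_int n\<bar> \<le> (cmod (of_int m + of_int n * \<i>))\<^sup>2"
proof -
  have c: "(cmod (of_int m + of_int n * \<i>))\<^sup>2 = (real_of_int m)\<^sup>2 + (real_of_int n)\<^sup>2"
    by (simp add: cmod_power2)
  have sq: "\<bar>real_of_int k\<bar> \<le> (real_of_int k)\<^sup>2" for k :: int
    by (metis of_int_abs of_int_le_iff of_int_power power2_abs self_le_power abs_ge_zero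
        int_one_le_iff_zero_less power2_eq_square zero_less_abs_iff mult_eq_0_iff pos2)
  have one: "k \<noteq> 0 \<Longrightarrow> 1 \<le> \<bar>real_of_int k\<bar>" for k :: int by linarith
  consider "m = 0" "n \<noteq> 0" | "m \<noteq> 0" "n = 0" | "m \<noteq> 0" "n \<noteq> 0" using assms by auto
  then show ?thesis
  proof cases
    case 3
    have "2 * (\<bar>real_of_int m\<bar> * \<bar>real_of_int n\<bar>) \<le> (real_of_int m)\<^sup>2 + (real_of_int n)\<^sup>2"
      using sum_squares_bound[of "\<bar>real_of_int m\<bar>" "\<bar>real_of_int n\<bar>"] by simp
    moreover have "0 \<le> \<bar>real_of_int m\<bar> * \<bar>real_of_int n\<bar>" by simp
    ultimately show ?thesis using one[OF 3(1)] one[OF 3(2)] unfolding c max_absorb2[OF one[OF 3(1)]] max_absorb2[OF one[OF 3(2)]] by linarith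
  qed (use c sq one in \<open>auto simp: max_def\<close>)
qed

text \<open>Raised to the power 3/2, the preceding bound dominates |w|^(-3) by a product of two
  one-variable terms of exponent -3/2, each of which has a convergent sum.\<close>

lemma summable_gaussian: "(\<lambda>w. 1 / norm w ^ 3) summable_on (period_lattice \<i> - {0})"
proof -
  let ?g = "\<lambda>n::int. max 1 \<bar>real_of_int n\<bar> powr (-3/2)"
  let ?h = "\<lambda>(m::int, n::int). of_int m + of_int n * \<i>"
  have inj: "inj ?h" by (auto simp: inj_on_def complex_eq_iff)
  have "(\<lambda>x. (case x of (m, n) \<Rightarrow> ?g m * ?g n)) summable_on UNIV \<times> UNIV"
    using summable_on_int_powr
    by (intro summable_on_SigmaI[where g = "\<lambda>m. ?g m * infsum ?g UNIV"])
       (auto intro!: has_sum_cmult_right summable_on_cmult_left)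
  then have s: "(\<lambda>(m, n). ?g m * ?g n) summable_on (UNIV - {(0,0)})"
    by (rule summable_on_subset_banach) auto
  have eq: "period_lattice \<i> - {0} = ?h ` (UNIV - {(0,0)})"
    unfolding period_lattice_image by (auto simp: complex_eq_iff)
  show ?thesis unfolding eq
  proof (subst summable_on_reindex)
    show "inj_on ?h (UNIV - {(0, 0)})" using inj by (rule inj_on_subset) auto
    show "((\<lambda>w. 1 / cmod w ^ 3) \<circ> ?h) summable_on UNIV - {(0, 0)}"
    proof (rule summable_on_comparison_test[OF s])
      fix x :: "int \<times> int" assume x: "x \<in> UNIV - {(0,0)}"
      obtain m n where mn: "x = (m, n)" by force
      let ?P = "max 1 \<bar>real_of_int m\<bar> * max 1 \<bar>real_of_int n\<bar>"
      let ?c = "cmod (of_int m + of_int n * \<i>)"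
      have P: "1 \<le> ?P" by (simp add: mult_ge1_I)
      have le: "?P \<le> ?c\<^sup>2" using gaussian_norm_bound[of m n] x mn by auto
      have c: "?c > 0" using x mn by (auto simp: complex_eq_iff)
      have "?P powr (3/2) \<le> (?c\<^sup>2) powr (3/2)" using le P by (intro powr_mono2) auto
      also have "(?c\<^sup>2) powr (3/2) = ?c ^ 3"
        using c by (simp add: powr_powr flip: powr_numeral)
      finally have "1 / ?c ^ 3 \<le> 1 / ?P powr (3/2)" using P by (intro divide_left_mono mult_pos_pos) (auto simp: c)
      also have "\<dots> = ?g m * ?g n" by (simp add: powr_minus powr_mult divide_simps)
      finally show "((\<lambda>w. 1 / cmod w ^ 3) \<circ> ?h) x \<le> (case x of (m, n) \<Rightarrow> ?g m * ?g n)"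
        by (simp add: mn)
    qed (auto simp: case_prod_beta)
  qed
qed

lemma finite_gaussian_ball: "finite {w \<in> period_lattice \<i>. norm w < r}"
proof (rule finite_subset)
  let ?k = "\<lceil>\<bar>r\<bar>\<rceil>"
  show "finite ((\<lambda>(m, n). of_int m + of_int n * \<i>) ` ({-?k..?k} \<times> {-?k..?k}))" by simp
  show "{w \<in> period_lattice \<i>. norm w < r} \<subseteq> (\<lambda>(m, n). of_int m + of_int n * \<i>) ` ({-?k..?k} \<times> {-?k..?k})"
  proof
    fix w assume "w \<in> {w \<in> period_lattice \<i>. norm w < r}"
    then obtain m n :: int where w: "w = of_int m + of_int n * \<i>" "norm w < r"
      by (auto simp: period_lattice_def)
    have "\<bar>real_of_int m\<bar> < r" "\<bar>real_of_int n\<bar> < r"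
      using abs_Re_le_cmod[of w] abs_Im_le_cmod[of w] w by auto
    then have "m \<in> {-?k..?k}" "n \<in> {-?k..?k}" by (simp; linarith)+
    then show "w \<in> (\<lambda>(m, n). of_int m + of_int n * \<i>) ` ({-?k..?k} \<times> {-?k..?k})" using w by auto
  qed
qed

lemma lattice_series:
  fixes f :: "complex \<Rightarrow> complex \<Rightarrow> complex"
  assumes K: "compact K" and A: "A \<subseteq> period_lattice \<i>"
    and cont: "\<And>w. w \<in> A \<Longrightarrow> continuous_on K (f w)"
    and le: "\<And>w z. z \<in> K \<Longrightarrow> r \<le> norm w \<Longrightarrow> norm (f w z) \<le> C / norm w ^ 3"
  shows "\<And>z. z \<in> K \<Longrightarrow> (\<lambda>w. f w z) summable_on A"
    and "continuous_on K (\<lambda>z. \<Sum>\<^sub>\<infinity>w\<in>A. f w z)"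
proof -
  have "(\<lambda>w. C * (1 / norm w ^ 3)) summable_on (period_lattice \<i> - {0})"
    by (intro summable_on_cmult_right summable_gaussian)
  moreover have "(\<lambda>w. C * (1 / norm w ^ 3)) summable_on {0}" by simp
  ultimately have "(\<lambda>w. C * (1 / norm w ^ 3)) summable_on (period_lattice \<i> - {0} \<union> {0})"
    by (rule summable_on_union)
  then have M: "(\<lambda>w. C / norm w ^ 3) summable_on A"
    using A by (auto elim!: summable_on_subset_banach)
  have le': "norm (f w z) \<le> C / norm w ^ 3" if "w \<in> A - {w \<in> period_lattice \<i>. norm w < r}" "z \<in> K" for w z
    using le that A by force
  show "\<And>z. z \<in> K \<Longrightarrow> (\<lambda>w. f w z) summable_on A"
    and "continuous_on K (\<lambda>z. \<Sum>\<^sub>\<infinity>w\<in>A. f w z)"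
    using compact_series_continuous[of K A f, OF K cont finite_gaussian_ball M le'] by blast+
qed

text \<open>Subtracting 1/w^2 gains one power of w, because the common numerator is z (2 w - z). For
  such w one has |z - w| \<ge> |w|/2 and |2 w - z| \<le> (5/2) |w|, which gives the constants 10 =
  (5/2) 2^2 and 8 = 2^3.\<close>

lemma wp_term_bound:
  fixes z w :: complex
  assumes z: "norm z \<le> r" and w: "2 * r + 1 \<le> norm w" "0 \<le> r"
  shows "norm (1 / (z - w)^2 - 1 / w^2) \<le> 10 * r / norm w ^ 3"
    and "norm (1 / (z - w)^3) \<le> 8 / norm w ^ 3"
proof -
  have w0: "norm w > 0" "w \<noteq> 0" using w by auto
  have zw: "norm w / 2 \<le> norm (z - w)"
    using norm_triangle_ineq2[of w z] z w by (simp add: norm_minus_commute)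
  then have zw0: "z \<noteq> w" using w0 by auto
  have eq: "1 / (z - w)^2 - 1 / w^2 = z * (2 * w - z) / (w^2 * (z - w)^2)"
    using w0 zw0 by (simp add: divide_simps) (simp add: power2_eq_square algebra_simps)
  have "norm (2 * w - z) \<le> 2 * norm w + norm z"
    using norm_triangle_ineq4[of "2 * w" z] by (simp add: norm_mult)
  also have "\<dots> \<le> 5/2 * norm w" using z w by simp
  finally have n1: "norm (2 * w - z) \<le> 5/2 * norm w" .
  have "norm (1 / (z - w)^2 - 1 / w^2) = norm z * norm (2 * w - z) / (norm w^2 * norm (z - w)^2)"
    unfolding eq by (simp add: norm_mult norm_divide norm_power)
  also have "\<dots> \<le> (r * (5/2 * norm w)) / (norm w^2 * (norm w / 2)^2)"
    using z n1 w w0 zw zw0 by (intro frac_le mult_mono power_mono mult_pos_pos) auto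
  also have "\<dots> = 10 * r / norm w ^ 3"
    using w0 by (simp add: field_simps power2_eq_square power3_eq_cube)
  finally show "norm (1 / (z - w)^2 - 1 / w^2) \<le> 10 * r / norm w ^ 3" .
  have "norm (1 / (z - w)^3) \<le> 1 / (norm w / 2)^3"
    using zw w0 zw0 by (auto simp: norm_divide norm_power intro!: divide_left_mono power_mono mult_pos_pos)
  then show "norm (1 / (z - w)^3) \<le> 8 / norm w ^ 3" by (simp add: field_simps power3_eq_cube)
qed

text \<open>Since \<open>1 / 0 = 0\<close>, the term \<open>1 / z ^ 2\<close> of the definition is the summand at \<open>w = 0\<close>.\<close>

lemma compact_wp:
  assumes K: "compact K" "K \<inter> period_lattice \<i> = {}"
  shows "\<And>z. z \<in> K \<Longrightarrow> (\<lambda>w. 1 / (z - w)^2 - 1 / w^2) summable_on period_lattice \<i>"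
    and "continuous_on K (\<lambda>z. \<Sum>\<^sub>\<infinity>w\<in>period_lattice \<i>. 1 / (z - w)^2 - 1 / w^2)"
    and "continuous_on K (\<lambda>z. \<Sum>\<^sub>\<infinity>w\<in>period_lattice \<i>. 1 / (z - w)^3)"
proof -
  obtain r where r: "r \<ge> 0" "\<And>z. z \<in> K \<Longrightarrow> norm z \<le> r"
    using compact_imp_bounded[OF K(1)] unfolding bounded_iff by (metis abs_ge_zero abs_ge_self order_trans)
  have c: "continuous_on K (\<lambda>z. 1 / (z - w)^n)" if "w \<in> period_lattice \<i>" for w n
    using that K(2) by (intro continuous_intros) auto
  note 1 = lattice_series[where A = "period_lattice \<i>" and f = "\<lambda>w z. 1 / (z - w)^2 - 1 / w^2" and
      r = "2 * r + 1" and C = "10 * r", OF K(1)]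
  show "\<And>z. z \<in> K \<Longrightarrow> (\<lambda>w. 1 / (z - w)^2 - 1 / w^2) summable_on period_lattice \<i>"
    using r by (rule_tac 1(1)) (auto intro!: continuous_intros c wp_term_bound[where r = r])
  show "continuous_on K (\<lambda>z. \<Sum>\<^sub>\<infinity>w\<in>period_lattice \<i>. 1 / (z - w)^2 - 1 / w^2)"
    using r by (rule_tac 1(2)) (auto intro!: continuous_on_diff continuous_on_const c wp_term_bound[where r = r])
  show "continuous_on K (\<lambda>z. \<Sum>\<^sub>\<infinity>w\<in>period_lattice \<i>. 1 / (z - w)^3)"
    using r by (rule_tac lattice_series(2)[where A = "period_lattice \<i>" and r = "2 * r + 1" and C = 8, OF K(1)])
      (auto intro!: c wp_term_bound[where r = r])
qed

lemma weierstrass_p_eq: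
  assumes "(\<lambda>w. 1 / (z - w)^2 - 1 / w^2) summable_on period_lattice \<tau>"
  shows "weierstrass_p \<tau> z = (\<Sum>\<^sub>\<infinity>w\<in>period_lattice \<tau>. 1 / (z - w)^2 - 1 / w^2)"
proof -
  let ?f = "\<lambda>w. 1 / (z - w)^2 - 1 / w^2"
  have 0: "0 \<in> period_lattice \<tau>" by (auto simp: period_lattice_def intro!: exI[of _ 0])
  have "infsum ?f (period_lattice \<tau>) = infsum ?f (insert 0 (period_lattice \<tau> - {0}))"
    using 0 by (simp add: insert_absorb)
  also have "\<dots> = ?f 0 + infsum ?f (period_lattice \<tau> - {0})"
    using assms by (intro infsum_insert) (auto elim!: summable_on_subset_banach)
  finally show ?thesis by (simp add: weierstrass_p_def)
qed

section \<open>Periodicity of the Weierstrass functions\<close>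

lemma period_lattice_diff: "w \<in> period_lattice \<tau> \<Longrightarrow> w' \<in> period_lattice \<tau> \<Longrightarrow> w - w' \<in> period_lattice \<tau>"
  unfolding period_lattice_def
  by (clarsimp, rule_tac x = "m - ma" in exI, rule_tac x = "n - na" in exI) (simp add: algebra_simps)

lemma period_lattice_add_iff: "w \<in> period_lattice \<tau> \<Longrightarrow> z + w \<in> period_lattice \<tau> \<longleftrightarrow> z \<in> period_lattice \<tau>"
proof -
  assume w: "w \<in> period_lattice \<tau>"
  have 0: "0 \<in> period_lattice \<tau>" by (auto simp: period_lattice_def intro!: exI[of _ 0])
  show ?thesis using period_lattice_diff[of "z + w" \<tau> w] period_lattice_diff[OF _ period_lattice_diff[OF 0 w], of z] w by auto
qed

lemma weierstrass_p'_period: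
  assumes "w \<in> period_lattice \<tau>"
  shows "weierstrass_p' \<tau> (z + w) = weierstrass_p' \<tau> z"
proof -
  have b: "bij_betw (\<lambda>v. v + w) (period_lattice \<tau>) (period_lattice \<tau>)"
    using assms by (intro bij_betwI[where g = "\<lambda>v. v - w"]) (auto simp: period_lattice_add_iff intro: period_lattice_diff)
  have "(\<Sum>\<^sub>\<infinity>v\<in>period_lattice \<tau>. 1 / (z + w - v)^3) = (\<Sum>\<^sub>\<infinity>v\<in>period_lattice \<tau>. 1 / (z + w - (v + w))^3)"
    by (rule infsum_reindex_bij_betw[OF b, symmetric])
  then show ?thesis by (simp add: weierstrass_p'_def)
qed

text \<open>
  Reindexing turns the difference of the two series into a sum whose terms are antisymmetric under
  \<open>v \<mapsto> w - v\<close>.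
\<close>

lemma weierstrass_p_period:
  assumes w: "w \<in> period_lattice \<i>" and z: "z \<notin> period_lattice \<i>"
  shows "weierstrass_p \<i> (z + w) = weierstrass_p \<i> z"
proof -
  let ?L = "period_lattice \<i>"
  have zw: "z + w \<notin> ?L" using assms by (simp add: period_lattice_add_iff)
  have s1: "(\<lambda>v. 1 / (z - v)^2 - 1 / v^2) summable_on ?L"
    and s2: "(\<lambda>v. 1 / (z + w - v)^2 - 1 / v^2) summable_on ?L"
    using compact_wp(1)[of "{z}"] compact_wp(1)[of "{z + w}"] z zw by auto
  have b: "bij_betw (\<lambda>v. v + w) ?L ?L"
    using assms by (intro bij_betwI[where g = "\<lambda>v. v - w"]) (auto simp: period_lattice_add_iff intro: period_lattice_diff)
  \<comment> \<open>The involution v \<mapsto> - w - v exchanges v and v + w up to sign, hence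
    exchanges the two squares in \<open>d\<close>.\<close>
  have b': "bij_betw (\<lambda>v. - w - v) ?L ?L"
    using assms period_lattice_diff[OF period_lattice_diff[of w \<i> w] w]
    by (intro bij_betwI[where g = "\<lambda>v. - w - v"]) (auto intro!: period_lattice_diff)
  have s3: "(\<lambda>v. 1 / (z - v)^2 - 1 / (v + w)^2) summable_on ?L"
    using summable_on_reindex_bij_betw[OF b, of "\<lambda>v. 1 / (z + w - v)^2 - 1 / v^2"] s2 by simp
  have e: "weierstrass_p \<i> (z + w) = (\<Sum>\<^sub>\<infinity>v\<in>?L. 1 / (z - v)^2 - 1 / (v + w)^2)"
    unfolding weierstrass_p_eq[OF s2]
    using infsum_reindex_bij_betw[OF b, of "\<lambda>v. 1 / (z + w - v)^2 - 1 / v^2"] by simp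
  define d where "d = (\<Sum>\<^sub>\<infinity>v\<in>?L. 1 / v^2 - 1 / (v + w)^2)"
  have d: "weierstrass_p \<i> (z + w) - weierstrass_p \<i> z = d"
    unfolding e weierstrass_p_eq[OF s1] d_def
    using infsum_add[OF s3 summable_on_uminus[THEN iffD2, OF s1]] unfolding infsum_uminus by simp
  have "d = (\<Sum>\<^sub>\<infinity>v\<in>?L. 1 / (- w - v)^2 - 1 / (- w - v + w)^2)"
    unfolding d_def by (rule infsum_reindex_bij_betw[OF b', symmetric])
  also have "\<dots> = (\<Sum>\<^sub>\<infinity>v\<in>?L. - (1 / v^2 - 1 / (v + w)^2))"
    by (intro infsum_cong) (simp add: power2_eq_square algebra_simps)
  also have "\<dots> = - d" unfolding d_def by (rule infsum_uminus)
  finally show ?thesis using d by simp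
qed

section \<open>Continuity off the Gaussian lattice\<close>

lemma closed_gaussian: "closed (period_lattice \<i>)"
proof -
  have "period_lattice \<i> = Re -` \<int> \<inter> Im -` \<int>"
    unfolding period_lattice_def by (auto simp: complex_eq_iff elim!: Ints_cases)
  then show ?thesis by (auto intro!: closed_Int closed_vimage continuous_intros closed_Ints)
qed

lemma continuous_on_weierstrass:
  "continuous_on (- period_lattice \<i>) (weierstrass_p \<i>)"
  "continuous_on (- period_lattice \<i>) (weierstrass_p' \<i>)"
proof -
  have op: "open (- period_lattice \<i>)" using closed_gaussian by auto
  have "continuous (at z) (weierstrass_p \<i>) \<and> continuous (at z) (weierstrass_p' \<i>)"
    if z: "z \<in> - period_lattice \<i>" for z
  proof -
    obtain e where e: "e > 0" "cball z e \<subseteq> - period_lattice \<i>"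
      using op z open_contains_cball by blast
    then have K: "compact (cball z e)" "cball z e \<inter> period_lattice \<i> = {}" by auto
    have z': "z \<in> interior (cball z e)" using e by simp
    have "continuous_on (cball z e) (weierstrass_p \<i>)"
      using compact_wp(2)[OF K] compact_wp(1)[OF K]
      by (subst continuous_on_cong[OF refl weierstrass_p_eq]) auto
    moreover have "continuous_on (cball z e) (weierstrass_p' \<i>)"
      unfolding weierstrass_p'_def using compact_wp(3)[OF K] by (intro continuous_intros)
    ultimately show ?thesis using continuous_on_interior z' by blast
  qed
  then show "continuous_on (- period_lattice \<i>) (weierstrass_p \<i>)"
    "continuous_on (- period_lattice \<i>) (weierstrass_p' \<i>)"
    using op by (auto simp: continuous_on_eq_continuous_at)
qed

section \<open>The group actions\<close>

definition aut_factor :: "int^2^2 \<Rightarrow> complex \<Rightarrow> complex" where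
  "aut_factor A \<tau> = of_int (A$2$1) * \<tau> + of_int (A$2$2)"

definition moebius :: "int^2^2 \<Rightarrow> complex \<Rightarrow> complex" where
  "moebius A \<tau> = (of_int (A$1$1) * \<tau> + of_int (A$1$2)) / aut_factor A \<tau>"

definition elliptic :: "int^2^2 \<Rightarrow> int \<Rightarrow> int \<Rightarrow> complex \<Rightarrow> complex \<Rightarrow> complex" where
  "elliptic A k l \<tau> z = (z + of_int k + of_int l * \<tau>) / aut_factor A \<tau>"

definition mat2 :: "int \<Rightarrow> int \<Rightarrow> int \<Rightarrow> int \<Rightarrow> int^2^2" where
  "mat2 p q r s = vector [vector [p, q], vector [r, s]]"

lemma mat2_sel [simp]:
  "mat2 p q r s $ 1 $ 1 = p" "mat2 p q r s $ 1 $ 2 = q"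
  "mat2 p q r s $ 2 $ 1 = r" "mat2 p q r s $ 2 $ 2 = s"
  by (simp_all add: mat2_def)

lemma mat2_eq_iff: "(A :: int^2^2) = B \<longleftrightarrow>
    A$1$1 = B$1$1 \<and> A$1$2 = B$1$2 \<and> A$2$1 = B$2$1 \<and> A$2$2 = B$2$2"
  by (auto simp: vec_eq_iff forall_2)

lemma matrix_mult_2_sel:
  fixes A B :: "int^2^2"
  shows "(A ** B) $ i $ j = A$i$1 * B$1$j + A$i$2 * B$2$j"
  by (simp add: matrix_matrix_mult_def sum_2)

lemma SL2Z_iff: "A \<in> carrier SL2Z \<longleftrightarrow> A$1$1 * A$2$2 - A$1$2 * A$2$1 = 1"
  by (simp add: SL2Z_def det_2)

definition inv2 :: "int^2^2 \<Rightarrow> int^2^2" where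
  "inv2 A = mat2 (A$2$2) (- A$1$2) (- A$2$1) (A$1$1)"

lemma inv2_sel [simp]:
  "inv2 A $ 1 $ 1 = A$2$2" "inv2 A $ 1 $ 2 = - A$1$2"
  "inv2 A $ 2 $ 1 = - A$2$1" "inv2 A $ 2 $ 2 = A$1$1"
  by (simp_all add: inv2_def)

lemma mat_1_sel [simp]:
  "(mat 1 :: int^2^2) $ 1 $ 1 = 1" "(mat 1 :: int^2^2) $ 1 $ 2 = 0"
  "(mat 1 :: int^2^2) $ 2 $ 1 = 0" "(mat 1 :: int^2^2) $ 2 $ 2 = 1"
  by (simp_all add: mat_def)

lemma SL2Z_inv2 [simp]: "A \<in> carrier SL2Z \<Longrightarrow> inv2 A \<in> carrier SL2Z"
  by (simp add: SL2Z_iff algebra_simps)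

lemma SL2Z_mat_1 [simp]: "mat 1 \<in> carrier SL2Z"
  by (simp add: SL2Z_iff)

lemma SL2Z_mult [simp]: "A \<in> carrier SL2Z \<Longrightarrow> B \<in> carrier SL2Z \<Longrightarrow> A ** B \<in> carrier SL2Z"
  by (simp add: SL2Z_def det_mul)

lemma inv2_mult [simp]:
  assumes "A \<in> carrier SL2Z"
  shows "inv2 A ** A = mat 1" "A ** inv2 A = mat 1"
  using assms by (auto simp: mat2_eq_iff matrix_mult_2_sel SL2Z_iff algebra_simps)

lemma aut_factor_nonzero:
  assumes "A \<in> carrier SL2Z" "Im \<tau> > 0"
  shows "aut_factor A \<tau> \<noteq> 0"
proof
  assume "aut_factor A \<tau> = 0"
  then have "of_int (A$2$1) * Im \<tau> = 0" "of_int (A$2$1) * Re \<tau> + of_int (A$2$2) = 0"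
    by (auto simp: aut_factor_def complex_eq_iff)
  then have "A$2$1 = 0" "A$2$2 = 0" using assms(2) by auto
  then show False using assms(1) by (simp add: SL2Z_iff)
qed

lemma Im_moebius_pos:
  assumes A: "A \<in> carrier SL2Z" and \<tau>: "Im \<tau> > 0"
  shows "Im (moebius A \<tau>) > 0"
proof -
  let ?j = "aut_factor A \<tau>"
  have "A$1$1 * A$2$2 - A$1$2 * A$2$1 = 1" using A by (simp add: SL2Z_iff)
  then have d: "real_of_int (A$1$1) * of_int (A$2$2) - of_int (A$1$2) * of_int (A$2$1) = 1"
    by (metis of_int_1 of_int_diff of_int_mult)
  have "Im (moebius A \<tau>) = Im ((of_int (A$1$1) * \<tau> + of_int (A$1$2)) * cnj ?j) / (cmod ?j)\<^sup>2"
    by (simp add: moebius_def Im_complex_div_eq_0 complex_div_cnj[of _ ?j] flip: of_real_power)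
  also have "Im ((of_int (A$1$1) * \<tau> + of_int (A$1$2)) * cnj ?j) =
      (real_of_int (A$1$1) * of_int (A$2$2) - of_int (A$1$2) * of_int (A$2$1)) * Im \<tau>"
    by (simp add: aut_factor_def algebra_simps)
  finally have "Im (moebius A \<tau>) = Im \<tau> / (cmod ?j)\<^sup>2" using d by simp
  then show ?thesis using aut_factor_nonzero[OF A \<tau>] \<tau> by simp
qed

lemma aut_factor_mult:
  assumes "B \<in> carrier SL2Z" "Im \<tau> > 0"
  shows "aut_factor (A ** B) \<tau> = aut_factor A (moebius B \<tau>) * aut_factor B \<tau>"
  using aut_factor_nonzero[OF assms]
  by (simp add: aut_factor_def[of A] aut_factor_def[of "A ** B"] moebius_def matrix_mult_2_sel field_simps)
     (simp add: aut_factor_def algebra_simps)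

lemma moebius_mult:
  assumes "A \<in> carrier SL2Z" "B \<in> carrier SL2Z" "Im \<tau> > 0"
  shows "moebius (A ** B) \<tau> = moebius A (moebius B \<tau>)"
proof -
  let ?\<tau> = "moebius B \<tau>"
  have j: "aut_factor B \<tau> \<noteq> 0" "aut_factor A ?\<tau> \<noteq> 0"
    using aut_factor_nonzero[OF assms(2,3)] aut_factor_nonzero[OF assms(1) Im_moebius_pos[OF assms(2,3)]] by auto
  have "of_int ((A ** B)$1$1) * \<tau> + of_int ((A ** B)$1$2) =
      (of_int (A$1$1) * ?\<tau> + of_int (A$1$2)) * aut_factor B \<tau>"
    using j by (simp add: moebius_def matrix_mult_2_sel field_simps)
      (simp add: aut_factor_def algebra_simps)
  then show ?thesis
    using j aut_factor_mult[OF assms(2,3), of A]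
    by (simp add: moebius_def[of "A ** B"] moebius_def[of A ?\<tau>])
qed

text \<open>Multiplied by \<open>aut_factor B \<tau>\<close>, the lattice vector k + l (B \<tau>)
  becomes a lattice vector of \<tau> whose coefficients are the row (l, k) times \<open>B\<close>.
  This is the group law of the semidirect product.\<close>

lemma elliptic_mult:
  assumes "A \<in> carrier SL2Z" "B \<in> carrier SL2Z" "Im \<tau> > 0"
  shows "elliptic A k l (moebius B \<tau>) (elliptic B k' l' \<tau> z) =
    elliptic (A ** B) (k' + k * B$2$2 + l * B$1$2) (l' + k * B$2$1 + l * B$1$1) \<tau> z"
proof -
  let ?\<tau> = "moebius B \<tau>" and ?j = "aut_factor B \<tau>"
  have j: "?j \<noteq> 0" "aut_factor A ?\<tau> \<noteq> 0"
    using aut_factor_nonzero[OF assms(2,3)] aut_factor_nonzero[OF assms(1) Im_moebius_pos[OF assms(2,3)]] by auto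
  have "(elliptic B k' l' \<tau> z + of_int k + of_int l * ?\<tau>) * ?j =
      z + of_int (k' + k * B$2$2 + l * B$1$2) + of_int (l' + k * B$2$1 + l * B$1$1) * \<tau>"
    using j by (simp add: elliptic_def moebius_def field_simps) (simp add: aut_factor_def algebra_simps)
  then show ?thesis
    using j aut_factor_mult[OF assms(2,3), of A]
    by (simp add: elliptic_def[of "A ** B"] elliptic_def[of A] divide_simps)
qed

lemma elliptic_1 [simp]: "elliptic (mat 1) 0 0 \<tau> z = z" "moebius (mat 1) \<tau> = \<tau>"
  by (simp_all add: elliptic_def moebius_def aut_factor_def)

lemma moebius_inverse:
  assumes A: "A \<in> carrier SL2Z" and \<tau>: "Im \<tau> > 0"
  shows "moebius (inv2 A) (moebius A \<tau>) = \<tau>" "moebius A (moebius (inv2 A) \<tau>) = \<tau>"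
  using moebius_mult[OF SL2Z_inv2[OF A] A \<tau>] moebius_mult[OF A SL2Z_inv2[OF A] \<tau>] A by simp_all

text \<open>The row (l, k) of the inverse element is minus the original row times
  \<open>inv2 A\<close>.\<close>

lemma elliptic_inverse:
  assumes A: "A \<in> carrier SL2Z" and \<tau>: "Im \<tau> > 0"
  shows "elliptic (inv2 A) (- k * A$1$1 + l * A$1$2) (k * A$2$1 - l * A$2$2) (moebius A \<tau>)
      (elliptic A k l \<tau> z) = z"
    and "elliptic A k l (moebius (inv2 A) \<tau>)
      (elliptic (inv2 A) (- k * A$1$1 + l * A$1$2) (k * A$2$1 - l * A$2$2) \<tau> z) = z"
proof -
  have d: "A$1$1 * A$2$2 = 1 + A$1$2 * A$2$1" using A by (simp add: SL2Z_iff)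
  have "k + (- k * A$1$1 + l * A$1$2) * A$2$2 + (k * A$2$1 - l * A$2$2) * A$1$2 =
      k - k * (A$1$1 * A$2$2) + k * (A$1$2 * A$2$1)"
    "l + (- k * A$1$1 + l * A$1$2) * A$2$1 + (k * A$2$1 - l * A$2$2) * A$1$1 =
      l - l * (A$1$1 * A$2$2) + l * (A$1$2 * A$2$1)"
    by (simp_all add: algebra_simps)
  then have "k + (- k * A$1$1 + l * A$1$2) * A$2$2 + (k * A$2$1 - l * A$2$2) * A$1$2 = 0"
    "l + (- k * A$1$1 + l * A$1$2) * A$2$1 + (k * A$2$1 - l * A$2$2) * A$1$1 = 0"
    unfolding d by (simp_all add: algebra_simps)
  then show "elliptic (inv2 A) (- k * A$1$1 + l * A$1$2) (k * A$2$1 - l * A$2$2) (moebius A \<tau>)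
      (elliptic A k l \<tau> z) = z"
    unfolding elliptic_mult[OF SL2Z_inv2[OF A] A \<tau>] by (simp add: A)
  show "elliptic A k l (moebius (inv2 A) \<tau>)
      (elliptic (inv2 A) (- k * A$1$1 + l * A$1$2) (k * A$2$1 - l * A$2$2) \<tau> z) = z"
    unfolding elliptic_mult[OF A SL2Z_inv2[OF A] \<tau>] by (simp add: A algebra_simps)
qed

lemma torelli_act_eq:
  "torelli_act (A, k2, l2, k3, l3) (\<tau>, z2, z3) = (moebius A \<tau>, elliptic A k2 l2 \<tau> z2, elliptic A k3 l3 \<tau> z3)"
  by (simp add: Let_def moebius_def elliptic_def aut_factor_def)

lemma jacobi_act_eq: "jacobi_act (A, k, l) (\<tau>, \<xi>) = (moebius A \<tau>, elliptic A k l \<tau> \<xi>)"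
  by (simp add: Let_def moebius_def elliptic_def aut_factor_def)

declare torelli_act.simps [simp del] jacobi_act.simps [simp del]

lemma period_lattice_moebius:
  assumes A: "A \<in> carrier SL2Z" and \<tau>: "Im \<tau> > 0"
  shows "period_lattice (moebius A \<tau>) = (\<lambda>w. w / aut_factor A \<tau>) ` period_lattice \<tau>"
proof (intro equalityI subsetI)
  let ?j = "aut_factor A \<tau>"
  have j: "?j \<noteq> 0" by (rule aut_factor_nonzero[OF A \<tau>])
  have eq: "of_int m + of_int n * moebius A \<tau> =
      (of_int (m * A$2$2 + n * A$1$2) + of_int (m * A$2$1 + n * A$1$1) * \<tau>) / ?j" for m n
    using j by (simp add: moebius_def field_simps) (simp add: aut_factor_def algebra_simps)
  show "w \<in> (\<lambda>w. w / ?j) ` period_lattice \<tau>" if "w \<in> period_lattice (moebius A \<tau>)" for w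
    using that unfolding period_lattice_def eq by blast
  show "w \<in> period_lattice (moebius A \<tau>)" if "w \<in> (\<lambda>w. w / ?j) ` period_lattice \<tau>" for w
  proof -
    from that obtain m n where w: "w = (of_int m + of_int n * \<tau>) / ?j"
      by (auto simp: period_lattice_def)
    let ?m = "m * A$1$1 - n * A$1$2" and ?n = "n * A$2$2 - m * A$2$1"
    have d: "A$1$1 * A$2$2 = 1 + A$1$2 * A$2$1" using A by (simp add: SL2Z_iff)
    have "?m * A$2$2 + ?n * A$1$2 = m * (A$1$1 * A$2$2 - A$1$2 * A$2$1)"
      "?m * A$2$1 + ?n * A$1$1 = n * (A$1$1 * A$2$2 - A$1$2 * A$2$1)"
      by (simp_all add: algebra_simps)
    then have "w = of_int ?m + of_int ?n * moebius A \<tau>" unfolding eq w using d by simp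
    then show ?thesis unfolding period_lattice_def by blast
  qed
qed

lemma divide_aut_factor_in_period_lattice:
  assumes "A \<in> carrier SL2Z" "Im \<tau> > 0"
  shows "z / aut_factor A \<tau> \<in> period_lattice (moebius A \<tau>) \<longleftrightarrow> z \<in> period_lattice \<tau>"
  using aut_factor_nonzero[OF assms] by (auto simp: period_lattice_moebius[OF assms])

lemma elliptic_in_period_lattice:
  assumes "A \<in> carrier SL2Z" "Im \<tau> > 0"
  shows "elliptic A k l \<tau> z \<in> period_lattice (moebius A \<tau>) \<longleftrightarrow> z \<in> period_lattice \<tau>"
proof -
  have "of_int k + of_int l * \<tau> \<in> period_lattice \<tau>" by (auto simp: period_lattice_def)
  then show ?thesis unfolding elliptic_def divide_aut_factor_in_period_lattice[OF assms]
    using period_lattice_add_iff[of "of_int k + of_int l * \<tau>" \<tau> z] by (simp add: add.assoc)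
qed

lemma elliptic_diff:
  "elliptic A k l \<tau> z - elliptic A k' l' \<tau> z' = elliptic A (k - k') (l - l') \<tau> (z - z')"
  by (simp add: elliptic_def diff_divide_distrib[symmetric] algebra_simps)

text \<open>The axioms assert the existence of acting elements and compare them pointwise on
  \<open>D\<close>, so the tuples need not be given a group structure; the same form serves the
  Torelli and the Jacobi action.\<close>

locale set_action =
  fixes act :: "'g \<Rightarrow> 'a \<Rightarrow> 'a" and G :: "'g set" and D :: "'a set"
  assumes act_closed: "g \<in> G \<Longrightarrow> x \<in> D \<Longrightarrow> act g x \<in> D"
    and act_one: "\<exists>e\<in>G. \<forall>x\<in>D. act e x = x"
    and act_mult: "g \<in> G \<Longrightarrow> h \<in> G \<Longrightarrow> \<exists>f\<in>G. \<forall>x\<in>D. act f x = act g (act h x)"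
    and act_inv: "g \<in> G \<Longrightarrow> \<exists>h\<in>G. \<forall>x\<in>D. act h (act g x) = x \<and> act g (act h x) = x"
begin

lemma orbit_eq_iff:
  assumes "x \<in> D" "y \<in> D"
  shows "orbit act G x = orbit act G y \<longleftrightarrow> (\<exists>g\<in>G. act g x = y)"
proof
  assume "orbit act G x = orbit act G y"
  moreover have "y \<in> orbit act G y" using act_one assms unfolding orbit_def by force
  ultimately have "y \<in> orbit act G x" by simp
  then show "\<exists>g\<in>G. act g x = y" by (auto simp: orbit_def)
next
  assume "\<exists>g\<in>G. act g x = y"
  then obtain g where g: "g \<in> G" "act g x = y" by blast
  obtain h where h: "h \<in> G" "act h y = x" using act_inv[OF g(1)] g assms by blast
  have "act f y \<in> orbit act G x" if "f \<in> G" for f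
    using act_mult[OF that g(1)] g assms by (force simp: orbit_def)
  moreover have "act f x \<in> orbit act G y" if "f \<in> G" for f
    using act_mult[OF that h(1)] h assms by (force simp: orbit_def)
  ultimately show "orbit act G x = orbit act G y" by (auto simp: orbit_def)
qed

lemma orbit_act: "g \<in> G \<Longrightarrow> x \<in> D \<Longrightarrow> orbit act G (act g x) = orbit act G x"
  using orbit_eq_iff[of x "act g x"] act_closed by blast

end

lemma set_action_subset:
  assumes "set_action act G D" "D' \<subseteq> D" "\<And>g x. g \<in> G \<Longrightarrow> x \<in> D' \<Longrightarrow> act g x \<in> D'"
  shows "set_action act G D'"
proof -
  interpret set_action act G D by fact
  show ?thesis
  proof
    show "\<exists>e\<in>G. \<forall>x\<in>D'. act e x = x"
      using act_one assms(2) by (meson subsetD)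
    show "\<exists>f\<in>G. \<forall>x\<in>D'. act f x = act g (act h x)" if "g \<in> G" "h \<in> G" for g h
      using act_mult[OF that] assms(2) by (meson subsetD)
    show "\<exists>h\<in>G. \<forall>x\<in>D'. act h (act g x) = x \<and> act g (act h x) = x" if "g \<in> G" for g
      using act_inv[OF that] assms(2) by (meson subsetD)
  qed (rule assms(3))
qed

lemma torelli_action: "set_action torelli_act torelli_group {(\<tau>, z2, z3). Im \<tau> > 0}"
proof
  fix g h :: torelli_elt and x :: "complex \<times> complex \<times> complex"
  assume g: "g \<in> torelli_group"
  obtain A k2 l2 k3 l3 where g_eq: "g = (A, k2, l2, k3, l3)" by (cases g)
  have A: "A \<in> carrier SL2Z" using g by (simp add: g_eq torelli_group_def)
  show "torelli_act g x \<in> {(\<tau>, z2, z3). Im \<tau> > 0}" if "x \<in> {(\<tau>, z2, z3). Im \<tau> > 0}"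
    using that A by (cases x) (auto simp: g_eq torelli_act_eq intro: Im_moebius_pos)
  show "\<exists>f\<in>torelli_group. \<forall>x\<in>{(\<tau>, z2, z3). Im \<tau> > 0}. torelli_act f x = torelli_act g (torelli_act h x)"
    if "h \<in> torelli_group"
  proof -
    obtain B k2' l2' k3' l3' where h_eq: "h = (B, k2', l2', k3', l3')" by (cases h)
    have B: "B \<in> carrier SL2Z" using that by (simp add: h_eq torelli_group_def)
    show ?thesis
      by (rule bexI[of _ "(A ** B, k2' + k2 * B$2$2 + l2 * B$1$2, l2' + k2 * B$2$1 + l2 * B$1$1,
           k3' + k3 * B$2$2 + l3 * B$1$2, l3' + k3 * B$2$1 + l3 * B$1$1)"])
         (use A B in \<open>auto simp: torelli_group_def h_eq g_eq torelli_act_eq elliptic_mult moebius_mult\<close>)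
  qed
  let ?h = "(inv2 A, - k2 * A$1$1 + l2 * A$1$2, k2 * A$2$1 - l2 * A$2$2,
      - k3 * A$1$1 + l3 * A$1$2, k3 * A$2$1 - l3 * A$2$2)"
  have 2: "torelli_act ?h (torelli_act g x) = x \<and> torelli_act g (torelli_act ?h x) = x"
    if "x \<in> {(\<tau>, z2, z3). Im \<tau> > 0}" for x
    using that moebius_inverse[OF A] elliptic_inverse[OF A] by (cases x) (simp add: g_eq torelli_act_eq)
  show "\<exists>h\<in>torelli_group. \<forall>x\<in>{(\<tau>, z2, z3). Im \<tau> > 0}.
      torelli_act h (torelli_act g x) = x \<and> torelli_act g (torelli_act h x) = x"
    by (rule bexI[of _ ?h]) (use A 2 in \<open>auto simp: torelli_group_def\<close>)
next
  show "\<exists>e\<in>torelli_group. \<forall>x\<in>{(\<tau>, z2, z3). Im \<tau> > 0}. torelli_act e x = x"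
    by (rule bexI[of _ "(mat 1, 0, 0, 0, 0)"]) (auto simp: torelli_group_def torelli_act_eq)
qed

lemma torelli_act_Torelli:
  assumes "g \<in> torelli_group" "x \<in> Torelli"
  shows "torelli_act g x \<in> Torelli"
proof -
  obtain A k2 l2 k3 l3 where g_eq: "g = (A, k2, l2, k3, l3)" by (cases g)
  obtain \<tau> z2 z3 where x_eq: "x = (\<tau>, z2, z3)" by (cases x)
  have A: "A \<in> carrier SL2Z" using assms by (simp add: g_eq torelli_group_def)
  have \<tau>: "Im \<tau> > 0" using assms by (simp add: x_eq Torelli_def)
  show ?thesis
    using assms(2) Im_moebius_pos[OF A \<tau>]
    by (simp add: g_eq x_eq Torelli_def torelli_act_eq elliptic_diff elliptic_in_period_lattice[OF A \<tau>])
qed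

interpretation Torelli: set_action torelli_act torelli_group Torelli
  by (rule set_action_subset[OF torelli_action _ torelli_act_Torelli]) (auto simp: Torelli_def)

lemma to_M13_eq_iff:
  "x \<in> Torelli \<Longrightarrow> y \<in> Torelli \<Longrightarrow> to_M13 x = to_M13 y \<longleftrightarrow> (\<exists>g\<in>torelli_group. torelli_act g x = y)"
  unfolding to_M13_def by (rule Torelli.orbit_eq_iff)

text \<open>Each identity is the substitution w \<mapsto> w / j in a sum, followed by pulling out a
  constant factor, which is legitimate for \<open>infsum\<close> whether or not it converges. The
  exponents of j are the weights in \<open>M13_weights\<close>.\<close>

lemma weierstrass_moebius:
  assumes A: "A \<in> carrier SL2Z" and \<tau>: "Im \<tau> > 0"
  shows "weierstrass_g2 (moebius A \<tau>) = aut_factor A \<tau> ^ 4 * weierstrass_g2 \<tau>"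
    and "weierstrass_g3 (moebius A \<tau>) = aut_factor A \<tau> ^ 6 * weierstrass_g3 \<tau>"
    and "weierstrass_p (moebius A \<tau>) (z / aut_factor A \<tau>) = aut_factor A \<tau> ^ 2 * weierstrass_p \<tau> z"
    and "weierstrass_p' (moebius A \<tau>) (z / aut_factor A \<tau>) = aut_factor A \<tau> ^ 3 * weierstrass_p' \<tau> z"
proof -
  let ?j = "aut_factor A \<tau>"
  have j: "?j \<noteq> 0" by (rule aut_factor_nonzero[OF A \<tau>])
  have bij: "bij_betw (\<lambda>w. w / ?j) (period_lattice \<tau>) (period_lattice (moebius A \<tau>))"
    using j by (auto simp: bij_betw_def inj_on_def period_lattice_moebius[OF A \<tau>])
  have bij0: "bij_betw (\<lambda>w. w / ?j) (period_lattice \<tau> - {0}) (period_lattice (moebius A \<tau>) - {0})"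
    using j by (auto simp: bij_betw_def inj_on_def period_lattice_moebius[OF A \<tau>])
  show "weierstrass_g2 (moebius A \<tau>) = ?j ^ 4 * weierstrass_g2 \<tau>"
    using j by (simp add: weierstrass_g2_def infsum_reindex_bij_betw[OF bij0, symmetric]
        power_divide infsum_cmult_right'[symmetric] mult.commute)
  show "weierstrass_g3 (moebius A \<tau>) = ?j ^ 6 * weierstrass_g3 \<tau>"
    using j by (simp add: weierstrass_g3_def infsum_reindex_bij_betw[OF bij0, symmetric]
        power_divide infsum_cmult_right'[symmetric] mult.commute)
  have "1 / (z / ?j - w / ?j)^n = ?j ^ n * (1 / (z - w)^n)" for w n
    by (simp add: diff_divide_distrib[symmetric] power_divide)
  note e = this
  show "weierstrass_p' (moebius A \<tau>) (z / ?j) = ?j ^ 3 * weierstrass_p' \<tau> z"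
    by (simp add: weierstrass_p'_def infsum_reindex_bij_betw[OF bij, symmetric]
        e infsum_cmult_right'[symmetric] mult.commute)
  have "1 / (z / ?j - w / ?j)^2 - 1 / (w / ?j)^2 = ?j ^ 2 * (1 / (z - w)^2 - 1 / w^2)" for w
    unfolding e by (simp add: power_divide right_diff_distrib)
  then show "weierstrass_p (moebius A \<tau>) (z / ?j) = ?j ^ 2 * weierstrass_p \<tau> z"
    by (simp add: weierstrass_p_def infsum_reindex_bij_betw[OF bij0, symmetric]
        infsum_cmult_right' power_divide distrib_left)
qed

lemma weighted_homogeneous_poly_scale:
  assumes P: "weighted_homogeneous_poly ws d P"
    and x: "length x = length ws" "length y = length ws"
    and y: "\<And>i. i < length ws \<Longrightarrow> y ! i = t ^ (ws ! i) * x ! i"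
  shows "P y = t ^ d * P x"
proof -
  obtain E c where E: "\<And>e. e \<in> E \<Longrightarrow> (\<Sum>i<length ws. ws ! i * e i) = d"
    and Peq: "\<And>x. length x = length ws \<Longrightarrow> P x = (\<Sum>e\<in>E. c e * (\<Prod>i<length ws. (x ! i) ^ e i))"
    using P unfolding weighted_homogeneous_poly_def by blast
  have "(\<Prod>i<length ws. (y ! i) ^ e i) = t ^ d * (\<Prod>i<length ws. (x ! i) ^ e i)" if "e \<in> E" for e
  proof -
    have "(\<Prod>i<length ws. (y ! i) ^ e i) = (\<Prod>i<length ws. t ^ (ws ! i * e i) * (x ! i) ^ e i)"
      by (intro prod.cong) (simp_all add: y power_mult_distrib power_mult)
    also have "\<dots> = t ^ (\<Sum>i<length ws. ws ! i * e i) * (\<Prod>i<length ws. (x ! i) ^ e i)"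
      by (simp add: prod.distrib power_sum)
    finally show ?thesis using E[OF that] by simp
  qed
  then show ?thesis by (simp add: Peq x sum_distrib_left mult.left_commute cong: sum.cong)
qed

lemma elliptic_gaussian:
  assumes "A \<in> carrier SL2Z" "z \<notin> period_lattice \<i>"
  shows "weierstrass_p (moebius A \<i>) (elliptic A k l \<i> z) = aut_factor A \<i> ^ 2 * weierstrass_p \<i> z"
    and "weierstrass_p' (moebius A \<i>) (elliptic A k l \<i> z) = aut_factor A \<i> ^ 3 * weierstrass_p' \<i> z"
proof -
  have w: "of_int k + of_int l * \<i> \<in> period_lattice \<i>" by (auto simp: period_lattice_def)
  show "weierstrass_p (moebius A \<i>) (elliptic A k l \<i> z) = aut_factor A \<i> ^ 2 * weierstrass_p \<i> z"
    "weierstrass_p' (moebius A \<i>) (elliptic A k l \<i> z) = aut_factor A \<i> ^ 3 * weierstrass_p' \<i> z"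
    unfolding elliptic_def using weierstrass_moebius(3,4)[OF assms(1), of \<i>]
      weierstrass_p_period[OF w assms(2)] weierstrass_p'_period[OF w, of z] by (simp_all add: add.assoc)
qed

text \<open>The value of \<open>P\<close> only picks up the nonzero factor
  \<open>aut_factor A \<i> ^ d\<close>. The starting point lies over \<i> because periodicity in z
  is available there; its image may lie over any point equivalent to \<i>.\<close>

lemma weighted_poly_zero_act:
  assumes P: "weighted_homogeneous_poly M13_weights d P"
    and g: "g \<in> torelli_group" and x: "(\<i>, z2, z3) \<in> Torelli"
  shows "P (weierstrass_coords (torelli_act g (\<i>, z2, z3))) = 0 \<longleftrightarrow> P (weierstrass_coords (\<i>, z2, z3)) = 0"
proof -
  obtain A k2 l2 k3 l3 where g_eq: "g = (A, k2, l2, k3, l3)" by (cases g)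
  have A: "A \<in> carrier SL2Z" using g by (simp add: g_eq torelli_group_def)
  have z: "z2 \<notin> period_lattice \<i>" "z3 \<notin> period_lattice \<i>" using x by (auto simp: Torelli_def)
  have "P (weierstrass_coords (torelli_act g (\<i>, z2, z3))) =
      aut_factor A \<i> ^ d * P (weierstrass_coords (\<i>, z2, z3))"
    by (rule weighted_homogeneous_poly_scale[OF P])
       (use A z in \<open>auto simp: M13_weights_def g_eq torelli_act_eq less_Suc_eq numeral_eq_Suc
         weierstrass_moebius[unfolded numeral_eq_Suc] elliptic_gaussian[unfolded numeral_eq_Suc]\<close>)
  then show ?thesis using aut_factor_nonzero[OF A, of \<i>] by simp
qed

text \<open>Multiplying the equation of the leaf at g x by the automorphy factor makes it affine in
  (\<tau>, z2, z3) again; the coefficients of \<tau> and 1 are then the entries of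
  \<open>leaf_act\<close>.\<close>

lemma torelli_act_leaf_iff:
  assumes "g \<in> torelli_group" "x \<in> Torelli"
  shows "torelli_act g x \<in> torelli_leaf \<alpha>2 \<alpha>3 a \<longleftrightarrow> x \<in> torelli_leaf \<alpha>2 \<alpha>3 (leaf_act \<alpha>2 \<alpha>3 g a)"
proof -
  obtain A k2 l2 k3 l3 where g_eq: "g = (A, k2, l2, k3, l3)" by (cases g)
  obtain \<tau> z2 z3 where x_eq: "x = (\<tau>, z2, z3)" by (cases x)
  obtain a0 a1 where a_eq: "a = (a0, a1)" by (cases a)
  have A: "A \<in> carrier SL2Z" using assms by (simp add: g_eq torelli_group_def)
  have \<tau>: "Im \<tau> > 0" using assms by (simp add: x_eq Torelli_def)
  note j = aut_factor_nonzero[OF A \<tau>]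
  have "of_real a0 * moebius A \<tau> + of_real \<alpha>2 * elliptic A k2 l2 \<tau> z2 +
      of_real \<alpha>3 * elliptic A k3 l3 \<tau> z3 = of_real a1 \<longleftrightarrow>
      of_real a0 * (of_int (A$1$1) * \<tau> + of_int (A$1$2)) + of_real \<alpha>2 * (z2 + of_int k2 + of_int l2 * \<tau>) +
      of_real \<alpha>3 * (z3 + of_int k3 + of_int l3 * \<tau>) = of_real a1 * aut_factor A \<tau>"
    using j by (simp add: moebius_def elliptic_def add_divide_distrib[symmetric] divide_eq_eq)
  also have "\<dots> \<longleftrightarrow> of_real (fst (leaf_act \<alpha>2 \<alpha>3 g a)) * \<tau> + of_real \<alpha>2 * z2 + of_real \<alpha>3 * z3
      = of_real (snd (leaf_act \<alpha>2 \<alpha>3 g a))"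
    by (simp add: a_eq g_eq aut_factor_def algebra_simps)
  finally show ?thesis
    using assms torelli_act_Torelli[OF assms]
    by (simp add: g_eq x_eq a_eq torelli_act_eq)
qed

definition leaf_orbit :: "real \<Rightarrow> real \<Rightarrow> real \<times> real \<Rightarrow> (real \<times> real) set" where
  "leaf_orbit \<alpha>2 \<alpha>3 a = (\<lambda>g. leaf_act \<alpha>2 \<alpha>3 g a) ` torelli_group"

lemma to_M13_in_leaf_iff:
  assumes "x \<in> Torelli"
  shows "to_M13 x \<in> M13_leaf \<alpha>2 \<alpha>3 a \<longleftrightarrow> (\<exists>b\<in>leaf_orbit \<alpha>2 \<alpha>3 a. x \<in> torelli_leaf \<alpha>2 \<alpha>3 b)"
proof
  have sub: "torelli_leaf \<alpha>2 \<alpha>3 a \<subseteq> Torelli" by (cases a) auto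
  assume "to_M13 x \<in> M13_leaf \<alpha>2 \<alpha>3 a"
  then obtain y where y: "y \<in> torelli_leaf \<alpha>2 \<alpha>3 a" "to_M13 x = to_M13 y"
    by (auto simp: M13_leaf_def)
  then obtain g where "g \<in> torelli_group" "torelli_act g x = y"
    using to_M13_eq_iff assms sub by blast
  then show "\<exists>b\<in>leaf_orbit \<alpha>2 \<alpha>3 a. x \<in> torelli_leaf \<alpha>2 \<alpha>3 b"
    using y torelli_act_leaf_iff[OF _ assms, of _ \<alpha>2 \<alpha>3 a] unfolding leaf_orbit_def by blast
next
  assume "\<exists>b\<in>leaf_orbit \<alpha>2 \<alpha>3 a. x \<in> torelli_leaf \<alpha>2 \<alpha>3 b"
  then obtain g where g: "g \<in> torelli_group" "x \<in> torelli_leaf \<alpha>2 \<alpha>3 (leaf_act \<alpha>2 \<alpha>3 g a)"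
    by (auto simp: leaf_orbit_def)
  then have "torelli_act g x \<in> torelli_leaf \<alpha>2 \<alpha>3 a" using torelli_act_leaf_iff assms by blast
  then show "to_M13 x \<in> M13_leaf \<alpha>2 \<alpha>3 a"
    using Torelli.orbit_act[OF g(1) assms] by (auto simp: M13_leaf_def to_M13_def)
qed

section \<open>Algebraic leaves have rational parameters\<close>

lemma countable_torelli_group: "countable torelli_group"
proof -
  have "inj (\<lambda>A :: int^2^2. (A$1$1, A$1$2, A$2$1, A$2$2))"
    by (auto simp: inj_def mat2_eq_iff)
  then have "countable (UNIV :: (int^2^2) set)"
    by (rule countableI')
  then have "countable ((UNIV :: (int^2^2) set) \<times> (UNIV :: (int \<times> int \<times> int \<times> int) set))"
    by (intro countable_SIGMA) auto
  then show ?thesis by (rule countable_subset[rotated]) (auto simp: torelli_group_def)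
qed

lemma countable_leaf_orbit: "countable (leaf_orbit \<alpha>2 \<alpha>3 a)"
  unfolding leaf_orbit_def by (intro countable_image countable_torelli_group)

lemma countable_period_lattice: "countable (period_lattice \<tau>)"
  unfolding period_lattice_image by (intro countable_image) auto

text \<open>Each condition fails on a countable set of z only, and the complex plane is uncountable.
  With \<open>\<beta>\<close> the right-hand side of the equation of a leaf over \<i>, the quotient
  by \<open>\<alpha>3\<close> is its z3 coordinate.\<close>

lemma generic_point:
  assumes \<alpha>: "\<alpha>2 \<noteq> 0" "\<alpha>3 \<noteq> 0" "\<alpha>2 + \<alpha>3 \<noteq> 0"
  obtains z :: complex where "z \<notin> period_lattice \<i>"
    "(\<beta> - of_real \<alpha>2 * z) / of_real \<alpha>3 \<notin> period_lattice \<i>"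
    "z - (\<beta> - of_real \<alpha>2 * z) / of_real \<alpha>3 \<notin> period_lattice \<i>"
proof -
  let ?L = "period_lattice \<i>"
  let ?a2 = "complex_of_real \<alpha>2" and ?a3 = "complex_of_real \<alpha>3"
  \<comment> \<open>The last two sets come from solving "the expression equals the lattice point w"
    for z, which uses \<open>\<alpha>2\<close> and \<open>\<alpha>2 + \<alpha>3\<close> as
    divisors.\<close>
  let ?B = "?L \<union> (\<lambda>w. (\<beta> - ?a3 * w) / ?a2) ` ?L \<union> (\<lambda>w. (?a3 * w + \<beta>) / (?a2 + ?a3)) ` ?L"
  have nz: "?a3 \<noteq> 0" "?a2 + ?a3 \<noteq> 0" using \<alpha> by (auto simp flip: of_real_add)
  have "countable ?B" by (intro countable_Un countable_image countable_period_lattice)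
  then obtain z where z: "z \<notin> ?B"
    using uncountable_UNIV_complex by (metis UNIV_eq_I)
  show ?thesis
  proof
    show "z \<notin> ?L" using z by auto
    show "(\<beta> - ?a2 * z) / ?a3 \<notin> ?L"
    proof
      assume *: "(\<beta> - ?a2 * z) / ?a3 \<in> ?L"
      have "z = (\<beta> - ?a3 * ((\<beta> - ?a2 * z) / ?a3)) / ?a2" using \<alpha>(1) nz by (simp add: field_simps)
      then show False using z * by blast
    qed
    show "z - (\<beta> - ?a2 * z) / ?a3 \<notin> ?L"
    proof
      assume *: "z - (\<beta> - ?a2 * z) / ?a3 \<in> ?L"
      have "z = (?a3 * (z - (\<beta> - ?a2 * z) / ?a3) + \<beta>) / (?a2 + ?a3)"
        using nz by (subst nonzero_eq_divide_eq) (simp_all add: field_simps)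
      then show False using z * by blast
    qed
  qed
qed

lemma continuous_on_weighted_poly:
  assumes P: "weighted_homogeneous_poly ws d P"
    and len: "\<And>x. length (f x) = length ws"
    and f: "\<And>i. i < length ws \<Longrightarrow> continuous_on S (\<lambda>x. f x ! i)"
  shows "continuous_on S (\<lambda>x. P (f x))"
proof -
  obtain E c where Peq: "\<And>x. length x = length ws \<Longrightarrow> P x = (\<Sum>e\<in>E. c e * (\<Prod>i<length ws. (x ! i) ^ e i))"
    using P unfolding weighted_homogeneous_poly_def by blast
  show ?thesis unfolding Peq[OF len] by (intro continuous_intros f) auto
qed

text \<open>
  It suffices to look at the fibre over \<open>\<tau> = \<i>\<close>: the preimage of the leaf there is the family of all
  affine lines with parameters in the orbit, and it is cut out by continuous equations.
\<close>

lemma closed_leaf_orbit: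
  assumes alg: "algebraic_in_M13 (M13_leaf \<alpha>2 \<alpha>3 a)"
    and \<alpha>: "\<alpha>2 \<noteq> 0" "\<alpha>3 \<noteq> 0" "\<alpha>2 + \<alpha>3 \<noteq> 0"
  shows "closed (leaf_orbit \<alpha>2 \<alpha>3 a)"
proof -
  let ?O = "leaf_orbit \<alpha>2 \<alpha>3 a"
  obtain \<P> where \<P>: "\<And>P. P \<in> \<P> \<Longrightarrow> \<exists>d. weighted_homogeneous_poly M13_weights d P"
    and V: "M13_leaf \<alpha>2 \<alpha>3 a = to_M13 ` {x \<in> Torelli. \<forall>P\<in>\<P>. P (weierstrass_coords x) = 0}"
    using alg unfolding algebraic_in_M13_def by blast
  have fibre: "(\<exists>b\<in>?O. (\<i>, z2, z3) \<in> torelli_leaf \<alpha>2 \<alpha>3 b) \<longleftrightarrow>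
      (\<forall>P\<in>\<P>. P (weierstrass_coords (\<i>, z2, z3)) = 0)" if x: "(\<i>, z2, z3) \<in> Torelli" for z2 z3
  proof -
    have "(\<exists>b\<in>?O. (\<i>, z2, z3) \<in> torelli_leaf \<alpha>2 \<alpha>3 b) \<longleftrightarrow> to_M13 (\<i>, z2, z3) \<in> M13_leaf \<alpha>2 \<alpha>3 a"
      using to_M13_in_leaf_iff[OF x] by simp
    also have "\<dots> \<longleftrightarrow> (\<forall>P\<in>\<P>. P (weierstrass_coords (\<i>, z2, z3)) = 0)"
    proof
      assume "to_M13 (\<i>, z2, z3) \<in> M13_leaf \<alpha>2 \<alpha>3 a"
      then obtain y where y: "y \<in> Torelli" "\<forall>P\<in>\<P>. P (weierstrass_coords y) = 0"
        "to_M13 (\<i>, z2, z3) = to_M13 y" unfolding V by blast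
      then obtain g where "g \<in> torelli_group" "torelli_act g (\<i>, z2, z3) = y"
        using to_M13_eq_iff[OF x] by blast
      then show "\<forall>P\<in>\<P>. P (weierstrass_coords (\<i>, z2, z3)) = 0"
        using y(2) \<P> weighted_poly_zero_act[OF _ _ x] by metis
    qed (use x V in blast)
    finally show ?thesis .
  qed
  have "b \<in> ?O" if b: "b \<in> closure ?O" for b
  proof -
    let ?\<beta> = "\<lambda>c :: real \<times> real. of_real (snd c) - of_real (fst c) * \<i>"
    obtain z where z: "z \<notin> period_lattice \<i>"
      "(?\<beta> b - of_real \<alpha>2 * z) / of_real \<alpha>3 \<notin> period_lattice \<i>"
      "z - (?\<beta> b - of_real \<alpha>2 * z) / of_real \<alpha>3 \<notin> period_lattice \<i>"
      using generic_point[OF \<alpha>, of "?\<beta> b"] .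
    \<comment> \<open>With z fixed, (\<i>, z, w c) is a transversal to the leaves: the real and
      imaginary parts of the equation over \<i> recover both entries of the parameter, so for c in
      \<open>N\<close> this point lies on the leaf of parameter c and on no other.\<close>
    define w where "w c = (?\<beta> c - of_real \<alpha>2 * z) / of_real \<alpha>3" for c
    define N where "N = w -` (- period_lattice \<i>) \<inter> (\<lambda>c. z - w c) -` (- period_lattice \<i>)"
    have w: "continuous_on UNIV w"
      unfolding w_def using \<alpha> by (intro continuous_intros) auto
    have "open N" unfolding N_def
      using closed_gaussian by (intro open_Int open_vimage continuous_intros w) auto
    have bN: "b \<in> N" using z by (simp add: N_def w_def)
    have T: "(\<i>, z, w c) \<in> Torelli" if "c \<in> N" for c
      using that z by (auto simp: N_def Torelli_def)
    have leaf: "(\<i>, z, w c) \<in> torelli_leaf \<alpha>2 \<alpha>3 c' \<longleftrightarrow> c' = c" if "c \<in> N" for c c'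
      using T[OF that] \<alpha>(2)
      by (cases c; cases c') (auto simp: w_def complex_eq_iff)
    have mem: "c \<in> ?O \<longleftrightarrow> (\<forall>P\<in>\<P>. P (weierstrass_coords (\<i>, z, w c)) = 0)" if "c \<in> N" for c
      using fibre[OF T[OF that]] leaf[OF that] by simp
    have "P (weierstrass_coords (\<i>, z, w b)) = 0" if P: "P \<in> \<P>" for P
    proof (rule ccontr)
      assume nz: "P (weierstrass_coords (\<i>, z, w b)) \<noteq> 0"
      obtain d where d: "weighted_homogeneous_poly M13_weights d P" using \<P>[OF P] by blast
      have wN: "continuous_on N w" "w ` N \<subseteq> - period_lattice \<i>"
        using w continuous_on_subset by (auto simp: N_def)
      have "continuous_on N (\<lambda>c. P (weierstrass_coords (\<i>, z, w c)))"
      proof (rule continuous_on_weighted_poly[OF d])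
        fix i assume "i < length M13_weights"
        then consider "i = 0" | "i = 1" | "i = 2" | "i = 3" | "i = 4" | "i = 5"
          by (auto simp: M13_weights_def less_Suc_eq numeral_eq_Suc)
        then show "continuous_on N (\<lambda>c. weierstrass_coords (\<i>, z, w c) ! i)"
          by cases (auto intro: continuous_on_compose2[OF continuous_on_weierstrass(1) wN]
              continuous_on_compose2[OF continuous_on_weierstrass(2) wN])
      qed (simp add: M13_weights_def)
      then have "open (N \<inter> (\<lambda>c. P (weierstrass_coords (\<i>, z, w c))) -` (- {0}))"
        by (rule continuous_open_preimage[OF _ \<open>open N\<close>]) auto
      \<comment> \<open>An open set containing the closure point \<open>b\<close> meets the orbit,
        but \<open>P\<close> vanishes at the orbit points in \<open>N\<close>.\<close>
      from open_Int_closure_eq_empty[OF this, of ?O]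
      obtain c where "c \<in> ?O" "c \<in> N" "P (weierstrass_coords (\<i>, z, w c)) \<noteq> 0"
        using b bN nz by auto
      then show False using mem P by blast
    qed
    then show ?thesis using mem[OF bN] by blast
  qed
  then show ?thesis by (metis closure_subset closure_closed subsetI subset_antisym closed_closure)
qed

lemma closed_countable_dense_imp_rational:
  fixes S :: "real set"
  assumes S: "closed S" "countable S" and t: "\<And>m n :: int. c + of_int m * \<theta>1 + of_int n * \<theta>2 \<in> S"
    and \<theta>2: "\<theta>2 \<noteq> 0"
  shows "\<theta>1 / \<theta>2 \<in> \<rat>"
proof (rule ccontr)
  assume irr: "\<theta>1 / \<theta>2 \<notin> \<rat>"
  \<comment> \<open>It suffices to fill one segment: it is uncountable. Fractional parts of k
    \<theta>1 / \<theta>2 approximate x, and removing the integer part only subtracts a multiple of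
    \<theta>2.\<close>
  have "c + \<theta>2 * x \<in> S" if x: "x \<in> {0..1}" for x
  proof -
    have "\<exists>y\<in>S. dist y (c + \<theta>2 * x) < e" if e: "e > 0" for e
    proof -
      obtain k where k: "\<bar>frac (real k * (\<theta>1 / \<theta>2)) - x\<bar> < e / \<bar>\<theta>2\<bar>"
        by (rule Kronecker_approx_1_explicit[OF irr, of x "e / \<bar>\<theta>2\<bar>"]) (use x \<theta>2 e in auto)
      let ?y = "c + \<theta>2 * frac (real k * (\<theta>1 / \<theta>2))"
      have "?y = c + of_int (int k) * \<theta>1 + of_int (- \<lfloor>real k * (\<theta>1 / \<theta>2)\<rfloor>) * \<theta>2"
        using \<theta>2 by (simp add: frac_def field_simps)
      then have "?y \<in> S" using t by metis
      moreover have "dist ?y (c + \<theta>2 * x) = \<bar>\<theta>2\<bar> * \<bar>frac (real k * (\<theta>1 / \<theta>2)) - x\<bar>"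
        by (simp add: dist_real_def abs_mult[symmetric] right_diff_distrib)
      moreover have "\<dots> < e" using k \<theta>2 by (simp add: field_simps)
      ultimately show ?thesis by metis
    qed
    then have "c + \<theta>2 * x \<in> closure S" by (auto simp: closure_approachable)
    then show ?thesis using S(1) by simp
  qed
  then have "(\<lambda>x. c + \<theta>2 * x) ` {0..1} \<subseteq> S" by auto
  then have "countable ((\<lambda>x. c + \<theta>2 * x) ` {0..1::real})" using S(2) countable_subset by blast
  then have "countable {0..1::real}"
    using \<theta>2 by (rule_tac countable_image_inj_on) (auto simp: inj_on_def)
  then show False using uncountable_closed_interval[of 0 "1::real"] by simp
qed

text \<open>Horizontal and vertical slices of the orbit are closed and countable subsets of a line.
  Translations move a0 by combinations of \<open>\<alpha>2\<close> and \<open>\<alpha>3\<close>;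
  upper unipotent matrices move a1 by multiples of a0, lower ones move a0 by multiples of a1, in
  each case together with translations by \<open>\<alpha>3\<close>.\<close>

lemma algebraic_leaf_rational:
  assumes alg: "algebraic_in_M13 (M13_leaf \<alpha>2 \<alpha>3 (a0, a1))"
    and \<alpha>: "\<alpha>2 \<noteq> 0" "\<alpha>3 \<noteq> 0" "\<alpha>2 + \<alpha>3 \<noteq> 0"
  shows "\<alpha>2 / \<alpha>3 \<in> \<rat>" "a0 / \<alpha>3 \<in> \<rat>" "a1 / \<alpha>3 \<in> \<rat>"
proof -
  let ?O = "leaf_orbit \<alpha>2 \<alpha>3 (a0, a1)"
  have O: "closed ?O" "countable ?O" using closed_leaf_orbit[OF assms] countable_leaf_orbit by auto
  have 1: "closed ((\<lambda>x. (x, y)) -` ?O)" "countable ((\<lambda>x. (x, y)) -` ?O)" for y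
    using O(1) by (auto intro!: closed_vimage continuous_on_Pair)
      (rule countable_subset[OF _ countable_image[OF O(2), of fst]], force)
  have 2: "closed ((\<lambda>y. (x, y)) -` ?O)" "countable ((\<lambda>y. (x, y)) -` ?O)" for x
    using O(1) by (auto intro!: closed_vimage continuous_on_Pair)
      (rule countable_subset[OF _ countable_image[OF O(2), of snd]], force)
  have mem: "leaf_act \<alpha>2 \<alpha>3 (A, k2, l2, k3, l3) (a0, a1) \<in> ?O" if "A \<in> carrier SL2Z" for A k2 l2 k3 l3
    unfolding leaf_orbit_def by (rule imageI) (use that in \<open>simp add: torelli_group_def\<close>)
  have SL: "mat2 1 q 0 1 \<in> carrier SL2Z" "mat2 1 0 q 1 \<in> carrier SL2Z" for q
    by (simp_all add: SL2Z_iff)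
  show "\<alpha>2 / \<alpha>3 \<in> \<rat>"
  proof (rule closed_countable_dense_imp_rational[OF 1[of a1], of a0])
    show "a0 + of_int m * \<alpha>2 + of_int n * \<alpha>3 \<in> (\<lambda>x. (x, a1)) -` ?O" for m n
      using mem[OF SL(1)[of 0], of 0 m 0 n] by (simp add: algebra_simps)
  qed (use \<alpha> in auto)
  show "a0 / \<alpha>3 \<in> \<rat>"
  proof (rule closed_countable_dense_imp_rational[OF 2[of a0], of a1])
    show "a1 + of_int m * a0 + of_int n * \<alpha>3 \<in> (\<lambda>y. (a0, y)) -` ?O" for m n
      using mem[OF SL(1)[of "- m"], of 0 0 "- n" 0] by (simp add: algebra_simps)
  qed (use \<alpha> in auto)
  show "a1 / \<alpha>3 \<in> \<rat>"
  proof (rule closed_countable_dense_imp_rational[OF 1[of a1], of a0])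
    show "a0 + of_int m * a1 + of_int n * \<alpha>3 \<in> (\<lambda>x. (x, a1)) -` ?O" for m n
      using mem[OF SL(2)[of "- m"], of 0 0 0 n] by (simp add: algebra_simps)
  qed (use \<alpha> in auto)
qed

section \<open>Holomorphic maps\<close>

text \<open>Holomorphy at a single point, with the complex structure of the target as an argument
  too, so that the chain rule can pass through maps between C^2 and C^3.\<close>

definition cdiff ::
  "(complex \<Rightarrow> 'a \<Rightarrow> 'a) \<Rightarrow> (complex \<Rightarrow> 'b \<Rightarrow> 'b) \<Rightarrow>
   ('a::real_normed_vector \<Rightarrow> 'b::real_normed_vector) \<Rightarrow> 'a \<Rightarrow> bool" where
  "cdiff sc sd f x \<longleftrightarrow> (\<exists>D. (f has_derivative D) (at x) \<and> (\<forall>c v. D (sc c v) = sd c (D v)))"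

lemma holomorphic_wrt_iff: "holomorphic_wrt sc U f \<longleftrightarrow> (\<forall>x\<in>U. cdiff sc (*) f x)"
  by (simp add: holomorphic_wrt_def cdiff_def)

lemma cdiff_compose:
  assumes "cdiff sc sd f x" "cdiff sd se g (f x)"
  shows "cdiff sc se (\<lambda>x. g (f x)) x"
  using assms unfolding cdiff_def by (metis has_derivative_compose)

lemma cdiff_transform:
  assumes "cdiff sc sd f x" "open S" "x \<in> S" "\<And>y. y \<in> S \<Longrightarrow> f y = g y"
  shows "cdiff sc sd g x"
  using assms unfolding cdiff_def by (metis has_derivative_transform_within_open)

lemma cdiff_isCont: "cdiff sc sd f x \<Longrightarrow> isCont f x"
  unfolding cdiff_def by (metis has_derivative_continuous)

lemma cdiff_const: "cdiff sc (*) (\<lambda>x. c) x"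
  unfolding cdiff_def by (intro exI[of _ "\<lambda>_. 0"]) auto

lemma cdiff_add:
  assumes "cdiff sc (*) f x" "cdiff sc (*) g x"
  shows "cdiff sc (*) (\<lambda>x. f x + g x :: complex) x"
proof -
  obtain D E where D: "(f has_derivative D) (at x)" "\<And>c v. D (sc c v) = c * D v"
    and E: "(g has_derivative E) (at x)" "\<And>c v. E (sc c v) = c * E v"
    using assms unfolding cdiff_def by auto
  show ?thesis unfolding cdiff_def
    by (rule exI[of _ "\<lambda>v. D v + E v"]) (auto simp: D E distrib_left intro: has_derivative_add)
qed

lemma cdiff_mult:
  assumes "cdiff sc (*) f x" "cdiff sc (*) g x"
  shows "cdiff sc (*) (\<lambda>x. f x * g x :: complex) x"
proof -
  obtain D E where D: "(f has_derivative D) (at x)" "\<And>c v. D (sc c v) = c * D v"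
    and E: "(g has_derivative E) (at x)" "\<And>c v. E (sc c v) = c * E v"
    using assms unfolding cdiff_def by auto
  show ?thesis unfolding cdiff_def
  proof (intro exI conjI allI)
    show "((\<lambda>x. f x * g x) has_derivative (\<lambda>v. f x * E v + D v * g x)) (at x)"
      by (rule has_derivative_mult[OF D(1) E(1)])
  qed (simp add: D E algebra_simps)
qed

lemma cdiff_inverse:
  assumes "cdiff sc (*) f x" "f x \<noteq> 0"
  shows "cdiff sc (*) (\<lambda>x. inverse (f x) :: complex) x"
proof -
  obtain D where D: "(f has_derivative D) (at x)" "\<And>c v. D (sc c v) = c * D v"
    using assms unfolding cdiff_def by auto
  show ?thesis unfolding cdiff_def
  proof (intro exI conjI allI)
    show "((\<lambda>x. inverse (f x)) has_derivative (\<lambda>v. - (inverse (f x) * D v * inverse (f x)))) (at x)"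
      by (rule Deriv.has_derivative_inverse[OF assms(2) D(1)])
  qed (simp add: D)
qed

lemma cdiff_divide:
  assumes "cdiff sc (*) f x" "cdiff sc (*) g x" "g x \<noteq> 0"
  shows "cdiff sc (*) (\<lambda>x. f x / g x :: complex) x"
  unfolding divide_inverse by (intro cdiff_mult cdiff_inverse assms)

lemma cdiff_diff:
  assumes "cdiff sc (*) f x" "cdiff sc (*) g x"
  shows "cdiff sc (*) (\<lambda>x. f x - g x :: complex) x"
  using cdiff_add[OF assms(1) cdiff_mult[OF cdiff_const[of sc "-1"] assms(2)]] by simp

lemma cdiff_coordinates:
  "cdiff scale2 (*) fst p" "cdiff scale2 (*) snd p"
  "cdiff scale3 (*) fst x" "cdiff scale3 (*) (\<lambda>x. fst (snd x)) x" "cdiff scale3 (*) (\<lambda>x. snd (snd x)) x"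
  unfolding cdiff_def
  by (intro exI[of _ fst] exI[of _ snd] exI[of _ "\<lambda>x. fst (snd x)"] exI[of _ "\<lambda>x. snd (snd x)"] conjI;
      auto intro!: derivative_eq_intros)+

lemma cdiff_pair2:
  assumes "cdiff sc (*) f x" "cdiff sc (*) g x"
  shows "cdiff sc scale2 (\<lambda>x. (f x, g x)) x"
proof -
  obtain D E where D: "(f has_derivative D) (at x)" "\<And>c v. D (sc c v) = c * D v"
    and E: "(g has_derivative E) (at x)" "\<And>c v. E (sc c v) = c * E v"
    using assms unfolding cdiff_def by auto
  show ?thesis unfolding cdiff_def
    by (rule exI[of _ "\<lambda>v. (D v, E v)"]) (auto simp: D E intro: has_derivative_Pair)
qed

lemma cdiff_pair3:
  assumes "cdiff sc (*) f x" "cdiff sc (*) g x" "cdiff sc (*) h x"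
  shows "cdiff sc scale3 (\<lambda>x. (f x, g x, h x)) x"
proof -
  obtain D E F where D: "(f has_derivative D) (at x)" "\<And>c v. D (sc c v) = c * D v"
    and E: "(g has_derivative E) (at x)" "\<And>c v. E (sc c v) = c * E v"
    and F: "(h has_derivative F) (at x)" "\<And>c v. F (sc c v) = c * F v"
    using assms unfolding cdiff_def by auto
  show ?thesis unfolding cdiff_def
    by (rule exI[of _ "\<lambda>v. (D v, E v, F v)"]) (auto simp: D E F intro!: has_derivative_Pair)
qed

lemmas cdiff_intros = cdiff_const cdiff_add cdiff_diff cdiff_mult cdiff_divide cdiff_coordinates
  cdiff_pair2 cdiff_pair3

lemma cdiff_torelli_act:
  assumes g: "g \<in> torelli_group" and x: "Im (fst x) > 0"
  shows "cdiff scale3 scale3 (torelli_act g) x"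
proof -
  obtain A k2 l2 k3 l3 where g_eq: "g = (A, k2, l2, k3, l3)" by (cases g)
  have A: "A \<in> carrier SL2Z" using g by (simp add: g_eq torelli_group_def)
  have "torelli_act g = (\<lambda>x. (moebius A (fst x), elliptic A k2 l2 (fst x) (fst (snd x)),
      elliptic A k3 l3 (fst x) (snd (snd x))))"
    by (auto simp: g_eq torelli_act_eq)
  then show ?thesis
    using aut_factor_nonzero[OF A x]
    by (simp add: moebius_def elliptic_def aut_factor_def) (intro cdiff_intros)
qed

section \<open>Openness of the Torelli space\<close>

lemma open_upper: "open {x :: complex \<times> 'a::topological_space. Im (fst x) > 0}"
  by (intro open_Collect_less continuous_intros)

text \<open>The two quotients are the real coordinates of z in the basis \<tau>, 1. In this form
  lattice membership can be followed while \<tau> varies.\<close>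

lemma period_lattice_iff:
  assumes "Im \<tau> > 0"
  shows "z \<in> period_lattice \<tau> \<longleftrightarrow> Im z / Im \<tau> \<in> \<int> \<and> Re z - Im z / Im \<tau> * Re \<tau> \<in> \<int>"
proof
  assume "z \<in> period_lattice \<tau>"
  then show "Im z / Im \<tau> \<in> \<int> \<and> Re z - Im z / Im \<tau> * Re \<tau> \<in> \<int>"
    using assms by (auto simp: period_lattice_def)
next
  assume *: "Im z / Im \<tau> \<in> \<int> \<and> Re z - Im z / Im \<tau> * Re \<tau> \<in> \<int>"
  then obtain m n where mn: "Im z / Im \<tau> = of_int n" "Re z - Im z / Im \<tau> * Re \<tau> = of_int m"
    by (metis Ints_cases)
  then have "z = of_int m + of_int n * \<tau>"
    using assms by (simp add: complex_eq_iff field_simps)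
  then show "z \<in> period_lattice \<tau>" by (auto simp: period_lattice_def)
qed

text \<open>The real coordinates of f x in the basis t x, 1 depend continuously on x, and the
  integers are closed; one of the two coordinates must avoid them.\<close>

lemma open_off_lattice:
  fixes f :: "'a::t2_space \<Rightarrow> complex" and t :: "'a \<Rightarrow> complex"
  assumes "open S" "continuous_on S t" "continuous_on S f" "\<And>x. x \<in> S \<Longrightarrow> Im (t x) > 0"
  shows "open {x \<in> S. f x \<notin> period_lattice (t x)}"
proof -
  let ?u = "\<lambda>x. Im (f x) / Im (t x)" and ?v = "\<lambda>x. Re (f x) - Im (f x) / Im (t x) * Re (t x)"
  have c: "continuous_on S ?u" "continuous_on S ?v"
    using assms(2-4) by (auto intro!: continuous_intros simp: less_imp_neq[symmetric])
  have "open (S \<inter> ?u -` (- \<int>))" "open (S \<inter> ?v -` (- \<int>))"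
    using c assms(1) by (auto intro!: continuous_open_preimage closed_Ints simp: open_Compl)
  then have "open ((S \<inter> ?u -` (- \<int>)) \<union> (S \<inter> ?v -` (- \<int>)))" by blast
  also have "(S \<inter> ?u -` (- \<int>)) \<union> (S \<inter> ?v -` (- \<int>)) = {x \<in> S. f x \<notin> period_lattice (t x)}"
    using assms(4) by (auto simp: period_lattice_iff)
  finally show ?thesis .
qed

lemma open_Torelli: "open Torelli"
proof -
  let ?H = "{x :: complex \<times> complex \<times> complex. Im (fst x) > 0}"
  have "open ({x \<in> ?H. fst (snd x) \<notin> period_lattice (fst x)} \<inter>
      {x \<in> ?H. snd (snd x) \<notin> period_lattice (fst x)} \<inter>
      {x \<in> ?H. fst (snd x) - snd (snd x) \<notin> period_lattice (fst x)})"
    by (intro open_Int open_off_lattice open_upper continuous_intros) auto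
  also have "\<dots> = Torelli" by (auto simp: Torelli_def)
  finally show ?thesis .
qed

section \<open>Congruence subgroups and the Jacobi group of level N\<close>

lemma Gamma1_iff:
  "A \<in> Gamma1 N \<longleftrightarrow> A \<in> carrier SL2Z \<and> int N dvd A$2$1 \<and> int N dvd A$2$2 - 1"
proof -
  have "int N dvd A$1$1 - 1" if "A \<in> carrier SL2Z" "int N dvd A$2$1" "int N dvd A$2$2 - 1"
  proof -
    \<comment> \<open>The determinant forces the remaining congruence, so the bottom row decides
      membership; the stabilizer equations will only speak of that row.\<close>
    have "A$1$1 * A$2$2 = 1 + A$1$2 * A$2$1" using that(1) by (simp add: SL2Z_iff)
    then have "A$1$1 - 1 = A$1$2 * A$2$1 - A$1$1 * (A$2$2 - 1)" by (simp add: algebra_simps)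
    then show ?thesis using that(2,3) by (metis dvd_diff dvd_mult)
  qed
  then show ?thesis by (auto simp: Gamma1_def cong_0_iff cong_iff_dvd_diff)
qed

lemma Gamma1_mult: "A \<in> Gamma1 N \<Longrightarrow> B \<in> Gamma1 N \<Longrightarrow> A ** B \<in> Gamma1 N"
  unfolding Gamma1_def
proof (clarsimp simp: matrix_mult_2_sel, intro conjI)
  assume A: "[A$1$1 = 1] (mod int N)" "[A$2$2 = 1] (mod int N)" "[A$2$1 = 0] (mod int N)"
    and B: "[B$1$1 = 1] (mod int N)" "[B$2$2 = 1] (mod int N)" "[B$2$1 = 0] (mod int N)"
  show "[A$1$1 * B$1$1 + A$1$2 * B$2$1 = 1] (mod int N)"
    using cong_add[OF cong_mult[OF A(1) B(1)] cong_mult[OF cong_refl B(3)]] by simp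
  show "[A$2$1 * B$1$2 + A$2$2 * B$2$2 = 1] (mod int N)"
    using cong_add[OF cong_mult[OF A(3) cong_refl] cong_mult[OF A(2) B(2)]] by simp
  show "[A$2$1 * B$1$1 + A$2$2 * B$2$1 = 0] (mod int N)"
    using cong_add[OF cong_mult[OF A(3) cong_refl] cong_mult[OF A(2) B(3)]] by simp
qed

lemma Gamma1_inv2: "A \<in> Gamma1 N \<Longrightarrow> inv2 A \<in> Gamma1 N"
  unfolding Gamma1_def by (auto simp: cong_0_iff)

lemma Gamma1_SL2Z: "A \<in> Gamma1 N \<Longrightarrow> A \<in> carrier SL2Z"
  by (simp add: Gamma1_def)

lemma Gamma1_1: "mat 1 \<in> Gamma1 N"
  by (simp add: Gamma1_def)

lemma set_action_jacobi: "set_action jacobi_act (jacobi_group N) {(\<tau>, \<xi>). Im \<tau> > 0}"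
proof
  fix g h :: jacobi_elt and x :: "complex \<times> complex"
  assume g: "g \<in> jacobi_group N"
  obtain A k l where g_eq: "g = (A, k, l)" by (cases g)
  have AN: "A \<in> Gamma1 N" using g by (simp add: g_eq jacobi_group_def)
  then have A: "A \<in> carrier SL2Z" by (rule Gamma1_SL2Z)
  show "jacobi_act g x \<in> {(\<tau>, \<xi>). Im \<tau> > 0}" if "x \<in> {(\<tau>, \<xi>). Im \<tau> > 0}"
    using that Im_moebius_pos[OF A] by (cases x) (auto simp: g_eq jacobi_act_eq)
  show "\<exists>f\<in>jacobi_group N. \<forall>x\<in>{(\<tau>, \<xi>). Im \<tau> > 0}. jacobi_act f x = jacobi_act g (jacobi_act h x)"
    if h: "h \<in> jacobi_group N"
  proof -
    obtain B k' l' where h_eq: "h = (B, k', l')" by (cases h)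
    have BN: "B \<in> Gamma1 N" using h by (simp add: h_eq jacobi_group_def)
    show ?thesis
      by (rule bexI[of _ "(A ** B, k' + k * B$2$2 + l * B$1$2, l' + k * B$2$1 + l * B$1$1)"])
         (use A Gamma1_SL2Z[OF BN] Gamma1_mult[OF AN BN] in
           \<open>auto simp: jacobi_group_def h_eq g_eq jacobi_act_eq elliptic_mult moebius_mult\<close>)
  qed
  let ?h = "(inv2 A, - k * A$1$1 + l * A$1$2, k * A$2$1 - l * A$2$2)"
  have "jacobi_act ?h (jacobi_act g x) = x \<and> jacobi_act g (jacobi_act ?h x) = x"
    if "x \<in> {(\<tau>, \<xi>). Im \<tau> > 0}" for x
    using that moebius_inverse[OF A] elliptic_inverse[OF A] by (cases x) (simp add: g_eq jacobi_act_eq)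
  then show "\<exists>h\<in>jacobi_group N. \<forall>x\<in>{(\<tau>, \<xi>). Im \<tau> > 0}.
      jacobi_act h (jacobi_act g x) = x \<and> jacobi_act g (jacobi_act h x) = x"
    by (intro bexI[of _ ?h]) (use Gamma1_inv2[OF AN] in \<open>auto simp: jacobi_group_def\<close>)
next
  show "\<exists>e\<in>jacobi_group N. \<forall>x\<in>{(\<tau>, \<xi>). Im \<tau> > 0}. jacobi_act e x = x"
    by (rule bexI[of _ "(mat 1, 0, 0)"]) (auto simp: jacobi_group_def Gamma1_1 jacobi_act_eq)
qed

interpretation Jacobi: set_action jacobi_act "jacobi_group N" "{(\<tau>, \<xi>). Im \<tau> > 0}" for N
  by (rule set_action_jacobi)

section \<open>Leaves in normal form\<close>

text \<open>
  A leaf in normal form: \<open>m2 z2 + m3 z3 = d / N\<close>. Since \<open>m2\<close> and \<open>m3\<close> are coprime,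
  \<open>(z2, z3) \<mapsto> (c3 z2 - c2 z3, m2 z2 + m3 z3)\<close> is a unimodular change of coordinates.
\<close>

locale normal_leaf =
  fixes m2 m3 c2 c3 d :: int and N :: nat
  assumes N: "N \<ge> 1" and coprime_d: "coprime d (int N)"
    and bezout: "m2 * c2 + m3 * c3 = 1"
    and m_nz: "m2 \<noteq> 0" "m3 \<noteq> 0" "m2 + m3 \<noteq> 0"
begin

definition level :: complex where "level = of_int d / of_nat N"

definition height :: "complex \<times> complex \<times> complex \<Rightarrow> complex" where
  "height x = of_int m2 * fst (snd x) + of_int m3 * snd (snd x)"

definition leaf :: "(complex \<times> complex \<times> complex) set" where
  "leaf = {x \<in> Torelli. height x = level}"

text \<open>The matrix with rows (c3, -c2) and (m2, m3) has determinant 1 by Bezout; its inverse is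
  applied here to the pair (\<xi>, \<open>level\<close>).\<close>

definition param :: "complex \<times> complex \<Rightarrow> complex \<times> complex \<times> complex" where
  "param p = (fst p, of_int c2 * level + of_int m3 * snd p, of_int c3 * level - of_int m2 * snd p)"

definition proj :: "complex \<times> complex \<times> complex \<Rightarrow> complex \<times> complex" where
  "proj x = (fst x, of_int c3 * fst (snd x) - of_int c2 * snd (snd x))"

definition dom :: "(complex \<times> complex) set" where
  "dom = {p. param p \<in> Torelli}"

text \<open>
  Near the leaf only stabilizing elements can return: the translates of the leaf have levels that
  differ by vectors of \<open>(1 / N) (\<int> + \<int> \<tau>)\<close>, and \<open>min 1 (Im \<tau>)\<close> bounds nonzero lattice vectors from
  below.
\<close>

definition tube :: "(complex \<times> complex \<times> complex) set" where
  "tube = {x \<in> Torelli. 2 * real N * cmod (height x - level) < min 1 (Im (fst x))}"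

text \<open>The stabilizer of the parameter (0, d / N) for the weights m2, m3, with denominators
  cleared so that the equations are over the integers.\<close>

definition stab :: "torelli_elt set" where
  "stab = {(A, k2, l2, k3, l3). A \<in> carrier SL2Z \<and>
     int N * (m2 * l2 + m3 * l3) = d * A$2$1 \<and> int N * (m2 * k2 + m3 * k3) = d * (A$2$2 - 1)}"

text \<open>The translations go through the same linear form as the coordinate \<xi> of
  \<open>proj\<close>, which makes \<open>proj\<close> equivariant.\<close>

fun to_jacobi :: "torelli_elt \<Rightarrow> jacobi_elt" where
  "to_jacobi (A, k2, l2, k3, l3) = (A, c3 * k2 - c2 * k3, c3 * l2 - c2 * l3)"

section \<open>Unimodular coordinates and the action in them\<close>

lemma bezout_complex: "of_int m2 * of_int c2 + of_int m3 * of_int c3 = (1 :: complex)"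
  by (metis bezout of_int_1 of_int_add of_int_mult)

lemma proj_param [simp]: "proj (param p) = p"
proof -
  have "of_int c3 * (of_int c2 * level + of_int m3 * snd p) - of_int c2 * (of_int c3 * level - of_int m2 * snd p)
      = (of_int m2 * of_int c2 + of_int m3 * of_int c3) * snd p"
    by (simp add: algebra_simps)
  then show ?thesis unfolding bezout_complex by (simp add: proj_def param_def prod_eq_iff)
qed

lemma height_param [simp]: "height (param p) = level"
proof -
  have "height (param p) = (of_int m2 * of_int c2 + of_int m3 * of_int c3) * level"
    by (simp add: height_def param_def algebra_simps)
  then show ?thesis unfolding bezout_complex by simp
qed

lemma param_proj: assumes "height x = level" shows "param (proj x) = x"
proof -
  have "of_int c2 * level + of_int m3 * snd (proj x) = (of_int m2 * of_int c2 + of_int m3 * of_int c3) * fst (snd x)"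
    "of_int c3 * level - of_int m2 * snd (proj x) = (of_int m2 * of_int c2 + of_int m3 * of_int c3) * snd (snd x)"
    unfolding assms[symmetric] by (simp_all add: proj_def height_def algebra_simps)
  then show ?thesis unfolding bezout_complex by (simp add: param_def proj_def prod_eq_iff)
qed

lemma leaf_eq: "leaf = param ` dom"
proof (intro equalityI subsetI)
  show "x \<in> param ` dom" if "x \<in> leaf" for x
    using that param_proj[of x] by (intro image_eqI[of _ _ "proj x"]) (auto simp: leaf_def dom_def)
qed (auto simp: leaf_def dom_def)

lemma leaf_subset_tube: "leaf \<subseteq> tube"
  by (auto simp: leaf_def tube_def Torelli_def)

lemma N_level: "of_nat N * level = of_int d"
  using N by (simp add: level_def)

lemma stab_Gamma1:
  assumes "(A, k2, l2, k3, l3) \<in> stab"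
  shows "A \<in> Gamma1 N"
proof -
  have A: "A \<in> carrier SL2Z" and *: "int N dvd d * A$2$1" "int N dvd d * (A$2$2 - 1)"
    using assms by (auto simp: stab_def intro: dvdI[of _ "int N"]) (metis dvd_triv_left)+
  have r: "int N dvd A$2$1" and s: "int N dvd A$2$2 - 1"
    using * coprime_d by (metis coprime_commute coprime_dvd_mult_right_iff)+
  show ?thesis using A r s by (simp add: Gamma1_iff)
qed

lemma height_act:
  assumes "(A, k2, l2, k3, l3) \<in> torelli_group" "Im (fst x) > 0"
  shows "aut_factor A (fst x) * height (torelli_act (A, k2, l2, k3, l3) x) =
    height x + of_int (m2 * k2 + m3 * k3) + of_int (m2 * l2 + m3 * l3) * fst x"
proof -
  have j: "aut_factor A (fst x) \<noteq> 0"
    using assms aut_factor_nonzero[of A "fst x"] by (simp add: torelli_group_def)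
  show ?thesis using j
    by (cases x) (simp add: height_def torelli_act_eq elliptic_def field_simps)
qed

lemma stab_height:
  assumes g: "g \<in> stab" and x: "Im (fst x) > 0" "height x = level"
  shows "height (torelli_act g x) = level"
proof -
  obtain A k2 l2 k3 l3 where g_eq: "g = (A, k2, l2, k3, l3)" by (cases g)
  have A: "A \<in> carrier SL2Z" using g by (simp add: g_eq stab_def)
  have j: "aut_factor A (fst x) \<noteq> 0" by (rule aut_factor_nonzero[OF A x(1)])
  have "int N * (m2 * l2 + m3 * l3) = d * A$2$1" "int N * (m2 * k2 + m3 * k3) = d * (A$2$2 - 1)"
    using g by (simp_all add: g_eq stab_def)
  then have e: "of_nat N * of_int (m2 * l2 + m3 * l3) = (of_int d * of_int (A$2$1) :: complex)"
    "of_nat N * of_int (m2 * k2 + m3 * k3) = (of_int d * (of_int (A$2$2) - 1) :: complex)"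
    by (metis of_int_mult of_int_of_nat_eq, metis of_int_mult of_int_of_nat_eq of_int_diff of_int_1)
  have "of_nat N * (aut_factor A (fst x) * height (torelli_act g x)) =
      of_nat N * level + of_nat N * of_int (m2 * k2 + m3 * k3) + of_nat N * of_int (m2 * l2 + m3 * l3) * fst x"
    using height_act[of A k2 l2 k3 l3 x] A x by (simp add: g_eq torelli_group_def distrib_left mult.assoc)
  also have "\<dots> = of_nat N * (aut_factor A (fst x) * level)"
    unfolding e N_level mult.left_commute[of "of_nat N" "aut_factor A (fst x)"]
    by (simp add: aut_factor_def algebra_simps)
  finally show ?thesis using j N by simp
qed

lemma proj_act:
  assumes g: "g \<in> torelli_group"
  shows "proj (torelli_act g x) = jacobi_act (to_jacobi g) (proj x)"
proof -
  obtain A k2 l2 k3 l3 where g_eq: "g = (A, k2, l2, k3, l3)" by (cases g)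
  show ?thesis
    by (cases x) (simp add: g_eq proj_def torelli_act_eq jacobi_act_eq elliptic_def
        diff_divide_distrib[symmetric] algebra_simps)
qed

lemma stab_to_jacobi: "g \<in> stab \<Longrightarrow> to_jacobi g \<in> jacobi_group N"
  using stab_Gamma1 by (cases g) (auto simp: jacobi_group_def)

lemma stab_torelli: "g \<in> stab \<Longrightarrow> g \<in> torelli_group"
  by (auto simp: stab_def torelli_group_def)

lemma jacobi_lift:
  assumes "j \<in> jacobi_group N"
  obtains g where "g \<in> stab" "to_jacobi g = j"
proof -
  obtain A k l where j_eq: "j = (A, k, l)" by (cases j)
  have A: "A \<in> Gamma1 N" using assms by (simp add: j_eq jacobi_group_def)
  have "int N dvd A$2$1" "int N dvd A$2$2 - 1" using A by (simp_all add: Gamma1_iff)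
  then obtain r s where rs: "A$2$1 = int N * r" "A$2$2 - 1 = int N * s" by (auto elim!: dvdE)
  \<comment> \<open>The second unimodular coordinate is free and set to k, l; the first must take
    the values d s, d r dictated by \<open>stab\<close>. Inverting the coordinate change gives the
    entries.\<close>
  let ?g = "(A, c2 * (d * s) + m3 * k, c2 * (d * r) + m3 * l, c3 * (d * s) - m2 * k, c3 * (d * r) - m2 * l)"
  have 1: "m2 * (c2 * X + m3 * Y) + m3 * (c3 * X - m2 * Y) = X" for X Y
  proof -
    have "m2 * (c2 * X + m3 * Y) + m3 * (c3 * X - m2 * Y) = (m2 * c2 + m3 * c3) * X" by (simp add: algebra_simps)
    then show ?thesis unfolding bezout by simp
  qed
  have 2: "c3 * (c2 * X + m3 * Y) - c2 * (c3 * X - m2 * Y) = Y" for X Y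
  proof -
    have "c3 * (c2 * X + m3 * Y) - c2 * (c3 * X - m2 * Y) = (m2 * c2 + m3 * c3) * Y" by (simp add: algebra_simps)
    then show ?thesis unfolding bezout by simp
  qed
  have "?g \<in> stab" using Gamma1_SL2Z[OF A] by (simp add: stab_def 1 rs)
  moreover have "to_jacobi ?g = j" by (simp add: j_eq 2)
  ultimately show ?thesis by (rule that)
qed

lemma lattice_vector_lower_bound:
  assumes "Im \<tau> > 0" "(m, n) \<noteq> (0, 0 :: int)"
  shows "min 1 (Im \<tau>) \<le> cmod (of_int m * \<tau> + of_int n)"
proof (cases "m = 0")
  case True
  then have "n \<noteq> 0" using assms(2) by simp
  then have "1 \<le> \<bar>real_of_int n\<bar>" by linarith
  then show ?thesis using True by simp
next
  case False
  then have "1 \<le> \<bar>real_of_int m\<bar>" by linarith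
  then have "Im \<tau> \<le> \<bar>real_of_int m\<bar> * Im \<tau>" using assms(1) by (simp add: mult_le_cancel_right1)
  also have "\<dots> = \<bar>Im (of_int m * \<tau> + of_int n)\<bar>" using assms(1) by (simp add: abs_mult)
  also have "\<dots> \<le> cmod (of_int m * \<tau> + of_int n)" by (rule abs_Im_le_cmod)
  finally show ?thesis by simp
qed

text \<open>With m, n the defects in the two equations of \<open>stab\<close>, the vector m \<tau> +
  n equals N times j (height (g x) - level) - (height x - level). Closeness at x is measured against
  the lattice of \<tau>, closeness at g x against the lattice of the image point. The vector is
  therefore bounded below in both lattices and the bounds are added; the factor 2 in
  \<open>tube\<close> pays for this.\<close>

lemma tube_stab:
  assumes x: "x \<in> tube" and g: "g \<in> torelli_group" and gx: "torelli_act g x \<in> tube"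
  shows "g \<in> stab"
proof -
  obtain A k2 l2 k3 l3 where g_eq: "g = (A, k2, l2, k3, l3)" by (cases g)
  obtain \<tau> z2 z3 where x_eq: "x = (\<tau>, z2, z3)" by (cases x)
  have A: "A \<in> carrier SL2Z" using g by (simp add: g_eq torelli_group_def)
  have \<tau>: "Im \<tau> > 0" using x by (simp add: x_eq tube_def Torelli_def)
  note \<tau>' = Im_moebius_pos[OF A \<tau>]
  let ?j = "aut_factor A \<tau>" and ?y = "torelli_act g x"
  have j: "?j \<noteq> 0" by (rule aut_factor_nonzero[OF A \<tau>])
  define n where "n = int N * (m2 * k2 + m3 * k3) - d * (A$2$2 - 1)"
  define m where "m = int N * (m2 * l2 + m3 * l3) - d * A$2$1"
  have "m = 0 \<and> n = 0"
  proof (rule ccontr)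
    assume nz: "\<not> (m = 0 \<and> n = 0)"
    \<comment> \<open>The coordinates of (m \<tau> + n) / j in the lattice of the image point: the
      row (m, n) times the inverse of \<open>A\<close>.\<close>
    let ?m = "m * A$2$2 - n * A$2$1" and ?n = "n * A$1$1 - m * A$1$2"
    have det: "A$1$1 * A$2$2 = 1 + A$1$2 * A$2$1" using A by (simp add: SL2Z_iff)
    have "m = ?m * A$1$1 + ?n * A$2$1" "n = ?m * A$1$2 + ?n * A$2$2"
      using det by (simp_all add: algebra_simps)
    then have nz': "(?m, ?n) \<noteq> (0, 0)" using nz by (metis Pair_inject add_0 mult_zero_left)
    have "(of_int ?m * moebius A \<tau> + of_int ?n) * ?j =
        of_int ?m * (of_int (A$1$1) * \<tau> + of_int (A$1$2)) + of_int ?n * ?j"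
      using j by (simp add: moebius_def field_simps)
    also have "\<dots> = of_int (?m * A$1$1 + ?n * A$2$1) * \<tau> + of_int (?m * A$1$2 + ?n * A$2$2)"
      by (simp add: aut_factor_def algebra_simps)
    also have "\<dots> = of_int m * \<tau> + of_int n"
      using \<open>m = ?m * A$1$1 + ?n * A$2$1\<close> \<open>n = ?m * A$1$2 + ?n * A$2$2\<close> by metis
    finally have v: "(of_int ?m * moebius A \<tau> + of_int ?n) * ?j = of_int m * \<tau> + of_int n" .
    have b1: "min 1 (Im \<tau>) \<le> cmod (of_int m * \<tau> + of_int n)"
      using nz by (intro lattice_vector_lower_bound \<tau>) auto
    have "min 1 (Im (moebius A \<tau>)) * cmod ?j \<le> cmod (of_int ?m * moebius A \<tau> + of_int ?n) * cmod ?j"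
      by (intro mult_right_mono lattice_vector_lower_bound \<tau>' nz') auto
    then have b2: "min 1 (Im (moebius A \<tau>)) * cmod ?j \<le> cmod (of_int m * \<tau> + of_int n)"
      by (simp only: norm_mult[symmetric] v)
    have h: "?j * height ?y = height x + of_int (m2 * k2 + m3 * k3) + of_int (m2 * l2 + m3 * l3) * \<tau>"
      using height_act[of A k2 l2 k3 l3 x] g \<tau> by (simp add: g_eq x_eq)
    have "of_int m * \<tau> + of_int n = of_nat N * (?j * height ?y) - of_nat N * height x - of_int d * ?j + of_int d"
      unfolding h by (simp add: m_def n_def aut_factor_def algebra_simps)
    also have "\<dots> = of_nat N * (?j * (height ?y - level) - (height x - level))"
      by (simp add: N_level[symmetric] algebra_simps)
    finally have "2 * cmod (of_int m * \<tau> + of_int n) = 2 * real N * cmod (?j * (height ?y - level) - (height x - level))"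
      by (simp add: norm_mult)
    also have "\<dots> \<le> 2 * real N * (cmod ?j * cmod (height ?y - level) + cmod (height x - level))"
      by (intro mult_left_mono) (auto simp: norm_mult[symmetric] intro: norm_triangle_ineq4)
    also have "\<dots> = cmod ?j * (2 * real N * cmod (height ?y - level)) + 2 * real N * cmod (height x - level)"
      by (simp add: algebra_simps)
    also have "\<dots> < cmod ?j * min 1 (Im (moebius A \<tau>)) + min 1 (Im \<tau>)"
    proof (rule add_strict_mono)
      show "2 * real N * cmod (height x - level) < min 1 (Im \<tau>)" using x by (simp add: tube_def x_eq)
      show "cmod ?j * (2 * real N * cmod (height ?y - level)) < cmod ?j * min 1 (Im (moebius A \<tau>))"
        using gx j by (intro mult_strict_left_mono) (auto simp: tube_def x_eq g_eq torelli_act_eq)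
    qed
    also have "\<dots> \<le> 2 * cmod (of_int m * \<tau> + of_int n)" using b1 b2 by (simp add: mult.commute)
    finally show False by simp
  qed
  then show ?thesis using A by (simp add: g_eq stab_def m_def n_def)
qed

abbreviation upper :: "(complex \<times> complex) set" where "upper \<equiv> {(\<tau>, \<xi>). Im \<tau> > 0}"

abbreviation jorbit :: "complex \<times> complex \<Rightarrow> (complex \<times> complex) set" where
  "jorbit \<equiv> orbit jacobi_act (jacobi_group N)"

lemma upper_eq: "upper = {p. Im (fst p) > 0}" by auto

lemma dom_upper: "dom \<subseteq> upper"
  by (auto simp: dom_def Torelli_def param_def)

lemma leaf_Torelli: "leaf \<subseteq> Torelli" and tube_Torelli: "tube \<subseteq> Torelli"
  by (auto simp: leaf_def tube_def)

lemma Torelli_upper: "x \<in> Torelli \<Longrightarrow> Im (fst x) > 0"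
  by (auto simp: Torelli_def)

lemma proj_upper: "x \<in> Torelli \<Longrightarrow> proj x \<in> upper"
  by (auto simp: Torelli_def proj_def)

lemma tube_jorbit_eq:
  assumes "x \<in> tube" "y \<in> tube" "to_M13 x = to_M13 y"
  shows "jorbit (proj x) = jorbit (proj y)"
proof -
  obtain g where g: "g \<in> torelli_group" "torelli_act g x = y"
    using assms to_M13_eq_iff tube_Torelli by blast
  then have "g \<in> stab" using tube_stab assms by blast
  then have "to_jacobi g \<in> jacobi_group N" by (rule stab_to_jacobi)
  moreover have "proj y = jacobi_act (to_jacobi g) (proj x)"
    using proj_act[OF g(1), of x] g(2) by simp
  ultimately show ?thesis
    using Jacobi.orbit_act[of "to_jacobi g" N "proj x"] proj_upper[of x] assms(1) tube_Torelli by auto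
qed

text \<open>A lift of j to \<open>stab\<close> preserves the level, so it sends
  \<open>param p\<close> to a point that \<open>param\<close> recovers from its projection, and by
  equivariance that projection is j p.\<close>

lemma param_jacobi:
  assumes j: "j \<in> jacobi_group N" and p: "p \<in> dom"
  shows "jacobi_act j p \<in> dom" "to_M13 (param (jacobi_act j p)) = to_M13 (param p)"
proof -
  obtain g where g: "g \<in> stab" "to_jacobi g = j" using jacobi_lift[OF j] .
  have T: "param p \<in> Torelli" using p by (simp add: dom_def)
  let ?y = "torelli_act g (param p)"
  have "height ?y = level" by (rule stab_height[OF g(1) Torelli_upper[OF T]]) simp
  then have eq: "param (jacobi_act j p) = ?y"
    using param_proj[of ?y] proj_act[OF stab_torelli[OF g(1)], of "param p"] g(2) by simp
  show "jacobi_act j p \<in> dom"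
    using torelli_act_Torelli[OF stab_torelli[OF g(1)] T] by (simp add: dom_def eq)
  show "to_M13 (param (jacobi_act j p)) = to_M13 (param p)"
    using to_M13_eq_iff[OF T torelli_act_Torelli[OF stab_torelli[OF g(1)] T]] stab_torelli[OF g(1)]
    unfolding eq by blast
qed

lemma jorbit_dom:
  assumes "p \<in> dom" "q \<in> upper" "jorbit p = jorbit q"
  shows "q \<in> dom" "to_M13 (param q) = to_M13 (param p)"
proof -
  obtain j where "j \<in> jacobi_group N" "jacobi_act j p = q"
    using assms Jacobi.orbit_eq_iff[of p q N] dom_upper by blast
  then show "q \<in> dom" "to_M13 (param q) = to_M13 (param p)" using param_jacobi assms(1) by blast+
qed

text \<open>Representatives are chosen in the whole tube and not just on the leaf: the map is
  thereby meaningful on a neighbourhood of the leaf, where it is the retraction used to extend open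
  sets and functions.\<close>

definition leaf_iso :: "(complex \<times> complex \<times> complex) set \<Rightarrow> (complex \<times> complex) set" where
  "leaf_iso P = jorbit (proj (SOME x. x \<in> tube \<and> to_M13 x = P))"

definition leaf_inv :: "(complex \<times> complex) set \<Rightarrow> (complex \<times> complex \<times> complex) set" where
  "leaf_inv Q = to_M13 (param (SOME p. p \<in> dom \<and> jorbit p = Q))"

lemma leaf_iso_eq: assumes "x \<in> tube" shows "leaf_iso (to_M13 x) = jorbit (proj x)"
proof -
  let ?y = "SOME y. y \<in> tube \<and> to_M13 y = to_M13 x"
  have "?y \<in> tube \<and> to_M13 ?y = to_M13 x" by (rule someI[of _ x]) (use assms in auto)
  then show ?thesis unfolding leaf_iso_def using tube_jorbit_eq assms by blast
qed

lemma leaf_inv_eq: assumes "p \<in> dom" shows "leaf_inv (jorbit p) = to_M13 (param p)"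
proof -
  let ?q = "SOME q. q \<in> dom \<and> jorbit q = jorbit p"
  have "?q \<in> dom \<and> jorbit ?q = jorbit p" by (rule someI[of _ p]) (use assms in auto)
  then show ?thesis unfolding leaf_inv_def using jorbit_dom(2)[OF assms, of ?q] dom_upper by auto
qed

lemma param_tube: "p \<in> dom \<Longrightarrow> param p \<in> tube"
  using leaf_eq leaf_subset_tube by auto

lemma leaf_iso_param: "p \<in> dom \<Longrightarrow> leaf_iso (to_M13 (param p)) = jorbit p"
  using leaf_iso_eq param_tube by simp

lemma cdiff_param: "cdiff scale2 scale3 param p"
  unfolding param_def by (intro cdiff_intros)

lemma cdiff_proj: "cdiff scale3 scale2 proj x"
  unfolding proj_def by (intro cdiff_intros)

lemma open_dom: "open dom"
proof -
  have "continuous_on UNIV param"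
    using cdiff_isCont[OF cdiff_param] by (simp add: continuous_on_eq_continuous_at)
  then show ?thesis unfolding dom_def using open_vimage[OF open_Torelli] by (simp add: vimage_def)
qed

lemma open_tube: "open tube"
proof -
  have "open {x. 2 * real N * cmod (height x - level) < min 1 (Im (fst x))}"
    unfolding height_def by (intro open_Collect_less continuous_intros)
  then have "open (Torelli \<inter> {x. 2 * real N * cmod (height x - level) < min 1 (Im (fst x))})"
    using open_Torelli by (rule open_Int[rotated])
  also have "Torelli \<inter> {x. 2 * real N * cmod (height x - level) < min 1 (Im (fst x))} = tube"
    by (auto simp: tube_def)
  finally show ?thesis .
qed

lemma open_tube_proj:
  assumes "open S" shows "open (tube \<inter> proj -` S)"
proof -
  have "continuous_on UNIV proj"
    using cdiff_isCont[OF cdiff_proj] by (simp add: continuous_on_eq_continuous_at)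
  then show ?thesis using open_tube open_vimage[OF assms] by blast
qed

end

section \<open>The isomorphism with an open part of the modular surface\<close>

lemma openin_M13_iff:
  "openin (underlying M13) U \<longleftrightarrow> U \<subseteq> to_M13 ` Torelli \<and> open {x \<in> Torelli. to_M13 x \<in> U}"
  by (simp add: M13_def quotient_cspace_def openin_quotient_topology to_M13_def openin_open_eq open_Torelli)

lemma regular_subcspace_iff:
  "regular (subcspace X A) V f \<longleftrightarrow> (\<forall>p\<in>V. \<exists>W F. openin (underlying X) W \<and> p \<in> W \<and> regular X W F \<and>
     (\<forall>q\<in>W \<inter> V. F q = f q))"
  by (simp add: subcspace_def)

lemma regular_M13_iff:
  "regular M13 U f \<longleftrightarrow> (\<forall>x\<in>Torelli. to_M13 x \<in> U \<longrightarrow> cdiff scale3 (*) (\<lambda>x. f (to_M13 x)) x)"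
  by (auto simp: M13_def quotient_cspace_def to_M13_def holomorphic_wrt_iff)

context normal_leaf
begin

lemma open_upper': "open upper"
  unfolding upper_eq by (rule open_upper)

lemma openin_surface_iff:
  "openin (underlying (elliptic_modular_surface N)) U \<longleftrightarrow>
    U \<subseteq> jorbit ` upper \<and> open {p \<in> upper. jorbit p \<in> U}"
  by (simp add: elliptic_modular_surface_def quotient_cspace_def openin_quotient_topology
      openin_open_eq open_upper') auto

lemma regular_surface_iff:
  "regular (elliptic_modular_surface N) U f \<longleftrightarrow>
    (\<forall>p\<in>upper. jorbit p \<in> U \<longrightarrow> cdiff scale2 (*) (\<lambda>p. f (jorbit p)) p)"
  by (auto simp: elliptic_modular_surface_def quotient_cspace_def holomorphic_wrt_iff)

lemma topspace_surface: "topspace (underlying (elliptic_modular_surface N)) = jorbit ` upper"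
  by (simp add: elliptic_modular_surface_def quotient_cspace_def)

lemma topspace_M13: "topspace (underlying M13) = to_M13 ` Torelli"
  by (simp add: M13_def quotient_cspace_def to_M13_def)

abbreviation X :: "(complex \<times> complex \<times> complex) set cspace" where
  "X \<equiv> subcspace M13 (to_M13 ` leaf)"

abbreviation Y :: "(complex \<times> complex) set cspace" where
  "Y \<equiv> subcspace (elliptic_modular_surface N) (jorbit ` dom)"

lemma topspace_X: "topspace (underlying X) = to_M13 ` leaf"
  using leaf_Torelli by (auto simp: subcspace_def topspace_M13)

lemma topspace_Y: "topspace (underlying Y) = jorbit ` dom"
  using dom_upper by (auto simp: subcspace_def topspace_surface)

lemma preimage_dom:
  assumes "U \<subseteq> jorbit ` dom"
  shows "{p \<in> upper. jorbit p \<in> U} = {p \<in> dom. jorbit p \<in> U}"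
proof -
  have "p \<in> dom" if "p \<in> upper" "jorbit p \<in> U" for p
    using that assms jorbit_dom(1)[of _ p] by auto
  then show ?thesis using dom_upper by blast
qed

lemma openin_surface_dom: "openin (underlying (elliptic_modular_surface N)) (jorbit ` dom)"
proof -
  have "{p \<in> upper. jorbit p \<in> jorbit ` dom} = dom"
    unfolding preimage_dom[OF order_refl] by auto
  then show ?thesis using dom_upper open_dom by (auto simp: openin_surface_iff)
qed

lemma openin_Y_iff: "openin (underlying Y) U \<longleftrightarrow> U \<subseteq> jorbit ` dom \<and> open {p \<in> dom. jorbit p \<in> U}"
proof -
  have "openin (underlying Y) U \<longleftrightarrow> openin (underlying (elliptic_modular_surface N)) U \<and> U \<subseteq> jorbit ` dom"
    by (simp add: subcspace_def openin_open_subtopology[OF openin_surface_dom])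
  also have "\<dots> \<longleftrightarrow> U \<subseteq> jorbit ` dom \<and> open {p \<in> dom. jorbit p \<in> U}"
    using preimage_dom[of U] image_mono[OF dom_upper, of jorbit] unfolding openin_surface_iff by auto
  finally show ?thesis .
qed

lemma continuous_on_torelli_act:
  assumes "g \<in> torelli_group"
  shows "continuous_on Torelli (torelli_act g)"
  by (intro continuous_at_imp_continuous_on ballI cdiff_isCont[OF cdiff_torelli_act[OF assms]] Torelli_upper)

lemma open_param_vimage: "open S \<Longrightarrow> open (param -` S)"
  by (intro open_vimage continuous_at_imp_continuous_on ballI cdiff_isCont[OF cdiff_param])

text \<open>The saturation of an open set is the union of its preimages under the group elements,
  all of which act continuously.\<close>

lemma openin_tube_image:
  assumes "open S"
  shows "openin (underlying M13) (to_M13 ` (tube \<inter> proj -` S))"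
proof -
  let ?B = "tube \<inter> proj -` S"
  have B: "open ?B" "?B \<subseteq> Torelli" using open_tube_proj[OF assms] tube_Torelli by auto
  have eq: "{x \<in> Torelli. to_M13 x \<in> to_M13 ` ?B} = (\<Union>g\<in>torelli_group. Torelli \<inter> torelli_act g -` ?B)"
  proof (intro equalityI subsetI)
    fix x assume x: "x \<in> {x \<in> Torelli. to_M13 x \<in> to_M13 ` ?B}"
    then obtain y where y: "y \<in> ?B" "to_M13 x = to_M13 y" by blast
    then obtain g where "g \<in> torelli_group" "torelli_act g x = y"
      using to_M13_eq_iff[of x y] x B(2) by blast
    then show "x \<in> (\<Union>g\<in>torelli_group. Torelli \<inter> torelli_act g -` ?B)" using x y(1) by blast
  next
    fix x assume "x \<in> (\<Union>g\<in>torelli_group. Torelli \<inter> torelli_act g -` ?B)"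
    then obtain g where g: "g \<in> torelli_group" "x \<in> Torelli" "torelli_act g x \<in> ?B" by blast
    then have "to_M13 x = to_M13 (torelli_act g x)"
      using to_M13_eq_iff[of x "torelli_act g x"] B(2) by blast
    then show "x \<in> {x \<in> Torelli. to_M13 x \<in> to_M13 ` ?B}" using g by blast
  qed
  have "open (\<Union>g\<in>torelli_group. Torelli \<inter> torelli_act g -` ?B)"
  proof (rule open_UN, rule ballI)
    fix g assume "g \<in> torelli_group"
    then show "open (Torelli \<inter> torelli_act g -` ?B)"
      by (rule continuous_open_preimage[OF continuous_on_torelli_act open_Torelli B(1)])
  qed
  then show ?thesis unfolding openin_M13_iff eq by (rule conjI[OF image_mono[OF B(2)]])
qed

lemma homeomorphic_map_leaf_iso: "homeomorphic_map (underlying X) (underlying Y) leaf_iso"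
proof -
  have 1: "continuous_map (underlying X) (underlying Y) leaf_iso"
    unfolding continuous_map_def
  proof (intro conjI allI impI)
    show "leaf_iso \<in> topspace (underlying X) \<rightarrow> topspace (underlying Y)"
      unfolding topspace_X topspace_Y unfolding leaf_eq using leaf_iso_param by auto
    fix U assume U: "openin (underlying Y) U"
    let ?S = "{p \<in> dom. jorbit p \<in> U}"
    \<comment> \<open>The induced topology asks for an ambient open set; the saturated piece of the
      tube over \<open>?S\<close> provides one. Its trace on the leaf is right because
      \<open>leaf_iso\<close> may be computed at any representative in the tube.\<close>
    have "{P \<in> to_M13 ` leaf. leaf_iso P \<in> U} = to_M13 ` (tube \<inter> proj -` ?S) \<inter> to_M13 ` leaf"
    proof (intro equalityI subsetI)
      fix P assume "P \<in> {P \<in> to_M13 ` leaf. leaf_iso P \<in> U}"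
      then obtain p where "p \<in> dom" "P = to_M13 (param p)" "jorbit p \<in> U"
        using leaf_iso_param by (auto simp: leaf_eq)
      then show "P \<in> to_M13 ` (tube \<inter> proj -` ?S) \<inter> to_M13 ` leaf"
        using param_tube by (auto simp: leaf_eq intro!: image_eqI[of _ _ "param p"])
    next
      fix P assume P: "P \<in> to_M13 ` (tube \<inter> proj -` ?S) \<inter> to_M13 ` leaf"
      then obtain x where "x \<in> tube" "jorbit (proj x) \<in> U" "P = to_M13 x" by auto
      then show "P \<in> {P \<in> to_M13 ` leaf. leaf_iso P \<in> U}" using P leaf_iso_eq by auto
    qed
    moreover have "open ?S" using U by (simp add: openin_Y_iff)
    ultimately have "openin (subtopology (underlying M13) (to_M13 ` leaf)) {P \<in> to_M13 ` leaf. leaf_iso P \<in> U}"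
      using openin_subtopology_Int[OF openin_tube_image[of ?S]] by simp
    then show "openin (underlying X) {P \<in> topspace (underlying X). leaf_iso P \<in> U}"
      unfolding topspace_X by (simp add: subcspace_def)
  qed
  have 2: "continuous_map (underlying Y) (underlying X) leaf_inv"
    unfolding continuous_map_def
  proof (intro conjI allI impI)
    show "leaf_inv \<in> topspace (underlying Y) \<rightarrow> topspace (underlying X)"
      unfolding topspace_X topspace_Y unfolding leaf_eq using leaf_inv_eq by auto
    fix U assume "openin (underlying X) U"
    then obtain T where T: "openin (underlying M13) T" "U = T \<inter> to_M13 ` leaf"
      by (auto simp: subcspace_def openin_subtopology)
    let ?V = "{Q \<in> jorbit ` dom. leaf_inv Q \<in> U}"
    have "{p \<in> dom. jorbit p \<in> ?V} = param -` {x \<in> Torelli. to_M13 x \<in> T}"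
      using leaf_inv_eq by (auto simp: T(2) leaf_eq dom_def)
    moreover have "open (param -` {x \<in> Torelli. to_M13 x \<in> T})"
      using T(1) unfolding openin_M13_iff by (intro open_param_vimage) blast
    ultimately show "openin (underlying Y) {Q \<in> topspace (underlying Y). leaf_inv Q \<in> U}"
      unfolding topspace_Y openin_Y_iff by auto
  qed
  have "homeomorphic_maps (underlying X) (underlying Y) leaf_iso leaf_inv"
    unfolding homeomorphic_maps_def topspace_X topspace_Y
  proof (intro conjI ballI 1 2)
    show "leaf_inv (leaf_iso P) = P" if "P \<in> to_M13 ` leaf" for P
      using that leaf_iso_param leaf_inv_eq by (auto simp: leaf_eq)
    show "leaf_iso (leaf_inv Q) = Q" if "Q \<in> jorbit ` dom" for Q
      using that leaf_iso_param leaf_inv_eq by auto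
  qed
  then show ?thesis by (rule homeomorphic_maps_imp_map)
qed

text \<open>Since \<open>dom\<close> is open and saturated, \<open>Y\<close> is an open part of the
  surface and a regular function is its own local extension.\<close>

lemma regular_Y_iff:
  assumes T: "openin (underlying Y) T"
  shows "regular Y T f \<longleftrightarrow> (\<forall>p\<in>dom. jorbit p \<in> T \<longrightarrow> cdiff scale2 (*) (\<lambda>p. f (jorbit p)) p)"
proof
  assume reg: "regular Y T f"
  show "\<forall>p\<in>dom. jorbit p \<in> T \<longrightarrow> cdiff scale2 (*) (\<lambda>p. f (jorbit p)) p"
  proof (intro ballI impI)
    fix p assume p: "p \<in> dom" "jorbit p \<in> T"
    obtain W F where W: "openin (underlying (elliptic_modular_surface N)) W" "jorbit p \<in> W"
      and F: "regular (elliptic_modular_surface N) W F" "\<forall>q\<in>W \<inter> T. F q = f q"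
      using bspec[OF reg[unfolded regular_subcspace_iff] p(2)] by (elim exE conjE) (rule that)
    show "cdiff scale2 (*) (\<lambda>p. f (jorbit p)) p"
    proof (rule cdiff_transform)
      show "cdiff scale2 (*) (\<lambda>p. F (jorbit p)) p"
        by (rule F(1)[unfolded regular_surface_iff, rule_format, OF subsetD[OF dom_upper p(1)] W(2)])
      show "open ({p \<in> upper. jorbit p \<in> W} \<inter> {p \<in> dom. jorbit p \<in> T})"
        using W(1) T unfolding openin_surface_iff openin_Y_iff by (intro open_Int) auto
      show "p \<in> {p \<in> upper. jorbit p \<in> W} \<inter> {p \<in> dom. jorbit p \<in> T}"
        using p W(2) subsetD[OF dom_upper p(1)] by simp
      show "F (jorbit q) = f (jorbit q)" if "q \<in> {p \<in> upper. jorbit p \<in> W} \<inter> {p \<in> dom. jorbit p \<in> T}" for q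
        by (rule bspec[OF F(2)]) (use that in simp)
    qed
  qed
next
  assume hol: "\<forall>p\<in>dom. jorbit p \<in> T \<longrightarrow> cdiff scale2 (*) (\<lambda>p. f (jorbit p)) p"
  have "openin (underlying (elliptic_modular_surface N)) T"
    using T by (simp add: subcspace_def openin_open_subtopology[OF openin_surface_dom])
  moreover have "regular (elliptic_modular_surface N) T f"
    unfolding regular_surface_iff
  proof (intro ballI impI)
    fix p assume "p \<in> upper" "jorbit p \<in> T"
    then have "p \<in> {p \<in> upper. jorbit p \<in> T}" by simp
    also have "\<dots> = {p \<in> dom. jorbit p \<in> T}" using T by (intro preimage_dom) (simp add: openin_Y_iff)
    finally show "cdiff scale2 (*) (\<lambda>p. f (jorbit p)) p" using hol by simp
  qed
  ultimately show "regular Y T f"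
    unfolding regular_subcspace_iff by (intro ballI exI[of _ T] exI[of _ f]) simp
qed

text \<open>Local extensions to the moduli space pull back along \<open>param\<close> to holomorphic
  functions. Conversely f composed with \<open>leaf_iso\<close> is already defined around the leaf,
  constant along the fibres of \<open>proj\<close> in the tube, and is itself the required
  extension.\<close>

lemma regular_X_iff:
  assumes T: "openin (underlying Y) T"
  shows "regular X {P \<in> to_M13 ` leaf. leaf_iso P \<in> T} (\<lambda>P. f (leaf_iso P)) \<longleftrightarrow>
    (\<forall>p\<in>dom. jorbit p \<in> T \<longrightarrow> cdiff scale2 (*) (\<lambda>p. f (jorbit p)) p)"
    (is "regular X ?V ?f \<longleftrightarrow> ?hol")
proof
  assume reg: "regular X ?V ?f"
  show ?hol
  proof (intro ballI impI)
    fix p assume p: "p \<in> dom" "jorbit p \<in> T"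
    then have pV: "to_M13 (param p) \<in> ?V" using leaf_iso_param by (auto simp: leaf_eq)
    obtain W F where W: "openin (underlying M13) W" "to_M13 (param p) \<in> W"
      and F: "regular M13 W F" "\<forall>P\<in>W \<inter> ?V. F P = ?f P"
      using bspec[OF reg[unfolded regular_subcspace_iff] pV] by (elim exE conjE) (rule that)
    show "cdiff scale2 (*) (\<lambda>p. f (jorbit p)) p"
    proof (rule cdiff_transform)
      have "cdiff scale3 (*) (\<lambda>x. F (to_M13 x)) (param p)"
        using F(1) W(2) p unfolding regular_M13_iff by (auto simp: dom_def)
      then show "cdiff scale2 (*) (\<lambda>p. F (to_M13 (param p))) p"
        by (rule cdiff_compose[OF cdiff_param])
      have "open (param -` {x \<in> Torelli. to_M13 x \<in> W})"
        using W(1) unfolding openin_M13_iff by (intro open_param_vimage) blast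
      then show "open (param -` {x \<in> Torelli. to_M13 x \<in> W} \<inter> {p \<in> dom. jorbit p \<in> T})"
        using T unfolding openin_Y_iff by (intro open_Int) auto
      show "p \<in> param -` {x \<in> Torelli. to_M13 x \<in> W} \<inter> {p \<in> dom. jorbit p \<in> T}"
        using p W by (auto simp: dom_def)
      fix q assume q: "q \<in> param -` {x \<in> Torelli. to_M13 x \<in> W} \<inter> {p \<in> dom. jorbit p \<in> T}"
      then have "to_M13 (param q) \<in> W \<inter> ?V" using leaf_iso_param by (auto simp: leaf_eq)
      from bspec[OF F(2) this] show "F (to_M13 (param q)) = f (jorbit q)"
        using q leaf_iso_param by simp
    qed
  qed
next
  assume hol: ?hol
  let ?S = "{p \<in> dom. jorbit p \<in> T}"
  let ?B = "tube \<inter> proj -` ?S"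
  have S: "open ?S" using T by (simp add: openin_Y_iff)
  have "regular M13 (to_M13 ` ?B) ?f"
    unfolding regular_M13_iff
  proof (intro ballI impI)
    fix x assume x: "x \<in> Torelli" "to_M13 x \<in> to_M13 ` ?B"
    then obtain y where y: "y \<in> ?B" "to_M13 x = to_M13 y" by blast
    then obtain g where g: "g \<in> torelli_group" "torelli_act g x = y"
      using to_M13_eq_iff x tube_Torelli by blast
    \<comment> \<open>The point x lies in the saturation of the tube but possibly outside the tube;
      near x the function is computed after moving into the tube by g.\<close>
    note act = cdiff_torelli_act[OF g(1)]
    show "cdiff scale3 (*) (\<lambda>x. ?f (to_M13 x)) x"
    proof (rule cdiff_transform)
      have "cdiff scale2 (*) (\<lambda>p. f (jorbit p)) (proj (torelli_act g x))" using hol y g by auto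
      then show "cdiff scale3 (*) (\<lambda>x. f (jorbit (proj (torelli_act g x)))) x"
        by (rule cdiff_compose[OF cdiff_compose[OF act[OF Torelli_upper[OF x(1)]] cdiff_proj]])
      show "open (Torelli \<inter> torelli_act g -` ?B)"
        by (intro continuous_open_preimage continuous_on_torelli_act[OF g(1)] open_Torelli open_tube_proj S)
      show "x \<in> Torelli \<inter> torelli_act g -` ?B" using x y g by auto
      fix x' assume x': "x' \<in> Torelli \<inter> torelli_act g -` ?B"
      then have "to_M13 x' = to_M13 (torelli_act g x')"
        using to_M13_eq_iff[of x' "torelli_act g x'"] torelli_act_Torelli[OF g(1)] g(1) by blast
      then show "f (jorbit (proj (torelli_act g x'))) = ?f (to_M13 x')"
        using leaf_iso_eq x' by auto
    qed
  qed
  moreover have "openin (underlying M13) (to_M13 ` ?B)" by (rule openin_tube_image[OF S])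
  moreover have "?V \<subseteq> to_M13 ` ?B"
  proof
    fix P assume "P \<in> ?V"
    then obtain p where "p \<in> dom" "P = to_M13 (param p)" "jorbit p \<in> T"
      using leaf_iso_param by (auto simp: leaf_eq)
    then show "P \<in> to_M13 ` ?B" using param_tube by (auto intro!: image_eqI[of _ _ "param p"])
  qed
  ultimately show "regular X ?V ?f"
    unfolding regular_subcspace_iff by (intro ballI exI[of _ "to_M13 ` ?B"] exI[of _ ?f]) (simp add: subset_iff)
qed

lemma cspace_iso_leaf_iso: "cspace_iso X Y leaf_iso"
  unfolding cspace_iso_def topspace_X
  by (intro conjI allI impI homeomorphic_map_leaf_iso) (simp only: regular_X_iff regular_Y_iff)

text \<open>Solving b + M \<xi> = k + l \<tau> gives one torsion section for each pair (k, l).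
  Changing k or l by a multiple of M translates \<xi> by a period, which lies in the Jacobi group,
  so the residues modulo |M| suffice.\<close>

lemma period_preimage_torsion:
  fixes M :: int and b :: rat
  assumes M: "M \<noteq> 0"
  obtains \<T> where "finite \<T>" "\<forall>C\<in>\<T>. torsion_multisection N C"
    "\<Union>\<T> = jorbit ` {p \<in> upper. of_rat b + of_int M * snd p \<in> period_lattice (fst p)}"
proof -
  define sec where "sec k l = {(\<tau>, (of_int k - of_rat b + of_int l * \<tau>) / of_int M) | \<tau>. Im \<tau> > 0}" for k l :: int
  let ?I = "{0..<\<bar>M\<bar>} \<times> {0..<\<bar>M\<bar>}"
  define \<T> where "\<T> = (\<lambda>(k, l). jorbit ` sec k l) ` ?I"
  have M': "of_int M \<noteq> (0 :: complex)" using M by simp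
  have tors: "torsion_multisection N (jorbit ` sec k l)" for k l
  proof -
    have "sec k l = {(\<tau>, of_rat ((of_int k - b) / of_int M) + of_rat (of_int l / of_int M) * \<tau>) | \<tau>. Im \<tau> > 0}"
      unfolding sec_def by (simp add: of_rat_divide of_rat_diff add_divide_distrib)
    then show ?thesis unfolding torsion_multisection_def by (intro exI) (rule arg_cong)
  qed
  show ?thesis
  proof
    show "finite \<T>" unfolding \<T>_def by (intro finite_imageI finite_cartesian_product) simp_all
    show "\<forall>C\<in>\<T>. torsion_multisection N C" unfolding \<T>_def using tors by auto
    show "\<Union>\<T> = jorbit ` {p \<in> upper. of_rat b + of_int M * snd p \<in> period_lattice (fst p)}"
    proof (intro equalityI subsetI)
      fix Q assume "Q \<in> \<Union>\<T>"
      then obtain k l where "Q \<in> jorbit ` sec k l" unfolding \<T>_def by blast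
      then obtain \<tau> where Q: "Q = jorbit (\<tau>, (of_int k - of_rat b + of_int l * \<tau>) / of_int M)" "Im \<tau> > 0"
        unfolding sec_def by blast
      have "of_rat b + of_int M * ((of_int k - of_rat b + of_int l * \<tau>) / of_int M) = of_int k + of_int l * \<tau>"
        using M' by simp
      then have "of_rat b + of_int M * ((of_int k - of_rat b + of_int l * \<tau>) / of_int M) \<in> period_lattice \<tau>"
        unfolding period_lattice_def by blast
      then show "Q \<in> jorbit ` {p \<in> upper. of_rat b + of_int M * snd p \<in> period_lattice (fst p)}"
        unfolding Q(1) using Q(2) by (intro imageI) simp
    next
      fix Q assume "Q \<in> jorbit ` {p \<in> upper. of_rat b + of_int M * snd p \<in> period_lattice (fst p)}"
      then obtain p where p: "Q = jorbit p" "p \<in> upper" "of_rat b + of_int M * snd p \<in> period_lattice (fst p)"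
        by blast
      obtain \<tau> \<xi> where p_eq: "p = (\<tau>, \<xi>)" by (cases p)
      have Q: "Q = jorbit (\<tau>, \<xi>)" "Im \<tau> > 0" "of_rat b + of_int M * \<xi> \<in> period_lattice \<tau>"
        using p by (simp_all add: p_eq)
      from Q(3) obtain k l where kl: "of_rat b + of_int M * \<xi> = of_int k + of_int l * \<tau>"
        unfolding period_lattice_def by blast
      let ?k = "k mod \<bar>M\<bar>" and ?l = "l mod \<bar>M\<bar>"
      obtain k' l' where k': "k = ?k + M * k'" and l': "l = ?l + M * l'"
      proof
        \<comment> \<open>The sign converts division by |M| into a multiple of M, which may be
          negative.\<close>
        show "k = ?k + M * (sgn M * (k div \<bar>M\<bar>))" "l = ?l + M * (sgn M * (l div \<bar>M\<bar>))"
          by (simp_all add: mult.assoc[symmetric] mult_sgn_abs linordered_idom_class.abs_sgn[symmetric])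
      qed
      let ?\<xi> = "(of_int ?k - of_rat b + of_int ?l * \<tau>) / of_int M :: complex"
      have "\<xi> = ?\<xi> + of_int k' + of_int l' * \<tau>"
      proof -
        have "of_int M * \<xi> = of_int (?k + M * k') - of_rat b + of_int (?l + M * l') * \<tau>"
          using kl k' l' by (metis add_diff_cancel_left' diff_add_eq)
        then show ?thesis using M' by (simp add: field_simps)
      qed
      then have "jacobi_act (mat 1, k', l') (\<tau>, ?\<xi>) = (\<tau>, \<xi>)"
        by (simp add: jacobi_act_eq elliptic_def moebius_def aut_factor_def)
      moreover have "(mat 1, k', l') \<in> jacobi_group N" by (simp add: jacobi_group_def Gamma1_1)
      ultimately have "jorbit (\<tau>, \<xi>) = jorbit (\<tau>, ?\<xi>)"
        using Jacobi.orbit_act[of "(mat 1, k', l')" N "(\<tau>, ?\<xi>)"] Q(2) by simp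
      then have "Q \<in> jorbit ` sec ?k ?l" using Q(1,2) unfolding sec_def by blast
      moreover have "(?k, ?l) \<in> ?I" using M by simp
      ultimately show "Q \<in> \<Union>\<T>" unfolding \<T>_def by blast
    qed
  qed
qed

text \<open>On the leaf, z2, z3 and z2 - z3 are affine in \<xi> with slopes m3, -m2 and m2 + m3 and
  with rational constant terms. The slopes are nonzero, so each condition defining the Torelli space
  removes finitely many torsion multi-sections.\<close>

lemma dom_complement_torsion:
  obtains \<T> where "finite \<T>" "\<forall>C\<in>\<T>. torsion_multisection N C"
    "jorbit ` dom = topspace (underlying (elliptic_modular_surface N)) - \<Union>\<T>"
proof -
  define r :: rat where "r = of_int d / of_nat N"
  have r: "of_rat r = level" by (simp add: r_def level_def of_rat_divide)
  define Z where "Z b M = {p \<in> upper. of_rat b + of_int M * snd p \<in> period_lattice (fst p)}" for b :: rat and M :: int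
  have Z: "\<exists>\<T>. finite \<T> \<and> (\<forall>C\<in>\<T>. torsion_multisection N C) \<and> \<Union>\<T> = jorbit ` Z b M" if "M \<noteq> 0" for b M
    unfolding Z_def by (rule period_preimage_torsion[OF that, of b]) (intro exI conjI)
  obtain \<T>1 where \<T>1: "finite \<T>1" "\<forall>C\<in>\<T>1. torsion_multisection N C" "\<Union>\<T>1 = jorbit ` Z (of_int c2 * r) m3"
    using Z[OF m_nz(2), of "of_int c2 * r"] by (elim exE conjE) (rule that)
  have m2': "- m2 \<noteq> 0" using m_nz(1) by simp
  obtain \<T>2 where \<T>2: "finite \<T>2" "\<forall>C\<in>\<T>2. torsion_multisection N C" "\<Union>\<T>2 = jorbit ` Z (of_int c3 * r) (- m2)"
    using Z[OF m2', of "of_int c3 * r"] by (elim exE conjE) (rule that)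
  obtain \<T>3 where \<T>3: "finite \<T>3" "\<forall>C\<in>\<T>3. torsion_multisection N C" "\<Union>\<T>3 = jorbit ` Z (of_int (c2 - c3) * r) (m2 + m3)"
    using Z[OF m_nz(3), of "of_int (c2 - c3) * r"] by (elim exE conjE) (rule that)
  have "p \<in> dom \<longleftrightarrow> p \<notin> Z (of_int c2 * r) m3 \<union> Z (of_int c3 * r) (- m2) \<union> Z (of_int (c2 - c3) * r) (m2 + m3)"
    if p: "p \<in> upper" for p
  proof -
    have "of_rat (of_int c2 * r) + of_int m3 * snd p = fst (snd (param p))"
      "of_rat (of_int c3 * r) + of_int (- m2) * snd p = snd (snd (param p))"
      "of_rat (of_int (c2 - c3) * r) + of_int (m2 + m3) * snd p = fst (snd (param p)) - snd (snd (param p))"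
      by (simp_all add: param_def of_rat_mult of_rat_diff left_diff_distrib distrib_right r)
    moreover have "fst (param p) = fst p" by (simp add: param_def)
    ultimately show ?thesis
      using p by (cases "param p") (simp add: dom_def Torelli_def Z_def case_prod_beta)
  qed
  then have "upper - dom = Z (of_int c2 * r) m3 \<union> Z (of_int c3 * r) (- m2) \<union> Z (of_int (c2 - c3) * r) (m2 + m3)"
    unfolding Z_def by blast
  then have "jorbit ` (upper - dom) = \<Union>(\<T>1 \<union> \<T>2 \<union> \<T>3)"
    unfolding Union_Un_distrib \<T>1(3) \<T>2(3) \<T>3(3) by (simp only: image_Un)
  \<comment> \<open>Passing to complements commutes with taking orbits because \<open>dom\<close> is
    a union of Jacobi orbits.\<close>
  moreover have "jorbit ` dom = jorbit ` upper - jorbit ` (upper - dom)"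
  proof (intro equalityI subsetI)
    fix Q assume "Q \<in> jorbit ` dom"
    then obtain p where "p \<in> dom" "Q = jorbit p" by blast
    then show "Q \<in> jorbit ` upper - jorbit ` (upper - dom)"
      using subsetD[OF dom_upper] jorbit_dom(1)[of p] by blast
  qed blast
  ultimately have "jorbit ` dom = topspace (underlying (elliptic_modular_surface N)) - \<Union>(\<T>1 \<union> \<T>2 \<union> \<T>3)"
    unfolding topspace_surface by simp
  moreover have "finite (\<T>1 \<union> \<T>2 \<union> \<T>3)" using \<T>1(1) \<T>2(1) \<T>3(1) by simp
  moreover have "\<forall>C\<in>\<T>1 \<union> \<T>2 \<union> \<T>3. torsion_multisection N C" using \<T>1(2) \<T>2(2) \<T>3(2) by blast
  ultimately show ?thesis by (intro that)
qed

end

section \<open>Reduction to the normal form\<close>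

lemma M13_leaf_act:
  assumes g: "g \<in> torelli_group"
  shows "M13_leaf \<alpha>2 \<alpha>3 (leaf_act \<alpha>2 \<alpha>3 g a) = M13_leaf \<alpha>2 \<alpha>3 a"
proof -
  have sub: "torelli_leaf \<alpha>2 \<alpha>3 b \<subseteq> Torelli" for b by (cases b) auto
  have to_M13_act: "to_M13 (torelli_act g x) = to_M13 x" if "x \<in> Torelli" for x
    using Torelli.orbit_act[OF g that] by (simp add: to_M13_def)
  show ?thesis unfolding M13_leaf_def
  proof (intro equalityI subsetI)
    fix P assume "P \<in> to_M13 ` torelli_leaf \<alpha>2 \<alpha>3 (leaf_act \<alpha>2 \<alpha>3 g a)"
    then obtain x where x: "x \<in> torelli_leaf \<alpha>2 \<alpha>3 (leaf_act \<alpha>2 \<alpha>3 g a)" "P = to_M13 x" by blast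
    then have "x \<in> Torelli" using sub by blast
    then show "P \<in> to_M13 ` torelli_leaf \<alpha>2 \<alpha>3 a"
      using torelli_act_leaf_iff[OF g, of x \<alpha>2 \<alpha>3 a] x to_M13_act[of x] by (metis imageI)
  next
    fix P assume "P \<in> to_M13 ` torelli_leaf \<alpha>2 \<alpha>3 a"
    then obtain y where y: "y \<in> torelli_leaf \<alpha>2 \<alpha>3 a" "P = to_M13 y" by blast
    then have yT: "y \<in> Torelli" using sub by blast
    obtain h where h: "h \<in> torelli_group" "torelli_act g (torelli_act h y) = y"
      using Torelli.act_inv[OF g] yT by blast
    have x: "torelli_act h y \<in> Torelli" by (rule torelli_act_Torelli[OF h(1) yT])
    then have "torelli_act h y \<in> torelli_leaf \<alpha>2 \<alpha>3 (leaf_act \<alpha>2 \<alpha>3 g a)"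
      using torelli_act_leaf_iff[OF g x, of \<alpha>2 \<alpha>3 a] h(2) y(1) by simp
    moreover have "P = to_M13 (torelli_act h y)" using to_M13_act[OF x] h(2) y(2) by simp
    ultimately show "P \<in> to_M13 ` torelli_leaf \<alpha>2 \<alpha>3 (leaf_act \<alpha>2 \<alpha>3 g a)" by blast
  qed
qed

lemma fraction_mult_Ints_iff:
  assumes "N \<ge> 1" "coprime d (int N)"
  shows "real_of_int d / real N * of_int c \<in> \<int> \<longleftrightarrow> int N dvd c"
proof
  assume "real_of_int d / real N * of_int c \<in> \<int>"
  then obtain k where "real_of_int d / real N * of_int c = of_int k" by (auto elim: Ints_cases)
  then have "real_of_int (d * c) = real_of_int (int N * k)" using assms(1) by (simp add: field_simps)
  then have "d * c = int N * k" by (simp only: of_int_eq_iff)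
  then have "int N dvd d * c" by simp
  then show "int N dvd c" using assms(2) by (metis coprime_commute coprime_dvd_mult_right_iff)
next
  assume "int N dvd c"
  then obtain k where "c = int N * k" by (auto elim: dvdE)
  then have "real_of_int d / real N * of_int c = of_int (d * k)" using assms(1) by simp
  then show "real_of_int d / real N * of_int c \<in> \<int>" by simp
qed

text \<open>Matrices act on parameters by right multiplication on the row (u, -v). Writing this row
  as g / n times a primitive one, a matrix whose first column annihilates it and whose second column
  comes from Bezout moves it to (0, - g / n); N is the reduced denominator of g / n.\<close>

lemma rational_row_normal_form:
  assumes "u \<in> \<rat>" "v \<in> \<rat>"
  obtains B and d :: int and N :: nat where "B \<in> carrier SL2Z" "N \<ge> 1" "coprime d (int N)"
    "u * of_int (B$1$1) - v * of_int (B$2$1) = 0" "v * of_int (B$2$2) - u * of_int (B$1$2) = real_of_int d / real N"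
proof -
  obtain p1 q1 :: int where 1: "q1 > 0" "u = of_int p1 / of_int q1" using assms(1) by (auto elim: Rats_cases')
  obtain p2 q2 :: int where 2: "q2 > 0" "v = of_int p2 / of_int q2" using assms(2) by (auto elim: Rats_cases')
  define n where "n = q1 * q2"
  define g where "g = gcd (p1 * q2) (p2 * q1)"
  have n: "n > 0" using 1 2 by (simp add: n_def)
  have u: "u = of_int (p1 * q2) / of_int n" and v: "v = of_int (p2 * q1) / of_int n"
    using 1 2 by (simp_all add: n_def)
  have "of_int g / of_int n \<in> (\<rat> :: real set)" by simp
  then obtain d b :: int where db: "b > 0" "coprime d b" "of_int g / of_int n = (of_int d / of_int b :: real)"
    by (rule Rats_cases')
  have N: "nat b \<ge> 1" "coprime d (int (nat b))" "of_int g / of_int n = real_of_int d / real (nat b)" using db by auto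
  show ?thesis
  proof (cases "g = 0")
    \<comment> \<open>Here d / N is 0 in lowest terms, so N = 1 and the level structure is
      trivial.\<close>
    case True
    then have "u = 0" "v = 0" using u v by (simp_all add: g_def)
    then show ?thesis using that[of "mat 1" "nat b" d] N True by simp
  next
    case False
    obtain u1 v1 where u1: "p1 * q2 = g * u1" and v1: "p2 * q1 = g * v1"
      unfolding g_def by (meson dvdE gcd_dvd1 gcd_dvd2)
    obtain x y where "x * (p1 * q2) + y * (p2 * q1) = g"
      unfolding g_def using bezout_int by blast
    then have "g * (x * u1 + y * v1) = g * 1" unfolding u1 v1 by (simp add: algebra_simps)
    then have xy: "x * u1 + y * v1 = 1" using False mult_cancel_left by blast
    let ?B = "mat2 v1 (- x) u1 y"
    have "?B \<in> carrier SL2Z" using xy by (simp add: SL2Z_iff algebra_simps)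
    moreover have "u * of_int v1 - v * of_int u1 = 0" unfolding u v u1 v1 by (simp add: algebra_simps)
    moreover have "v * of_int y - u * of_int (- x) = of_int (g * (x * u1 + y * v1)) / of_int n"
      unfolding u v u1 v1 by (simp add: add_divide_distrib algebra_simps)
    ultimately show ?thesis using that[of ?B "nat b" d] N xy by simp
  qed
qed

text \<open>The number \<open>\<mu>\<close> is a common measure: the weights are
  \<open>\<mu>\<close> m2 and \<open>\<mu>\<close> m3, the parameter is \<open>\<mu>\<close> (u, v),
  and \<open>B\<close> carries it to the normal form.\<close>

locale rational_leaf = normal_leaf +
  fixes \<mu> u v :: real and B :: "int^2^2"
  assumes \<mu>: "\<mu> \<noteq> 0" and B: "B \<in> carrier SL2Z"
    and B1: "u * of_int (B$1$1) - v * of_int (B$2$1) = 0"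
    and B2: "v * of_int (B$2$2) - u * of_int (B$1$2) = real_of_int d / real N"
begin

abbreviation \<beta>2 :: real where "\<beta>2 \<equiv> \<mu> * of_int m2"
abbreviation \<beta>3 :: real where "\<beta>3 \<equiv> \<mu> * of_int m3"

lemma M13_leaf_eq: "M13_leaf \<beta>2 \<beta>3 (\<mu> * u, \<mu> * v) = to_M13 ` leaf"
proof -
  have g: "(B, 0, 0, 0, 0) \<in> torelli_group" using B by (simp add: torelli_group_def)
  have "leaf_act \<beta>2 \<beta>3 (B, 0, 0, 0, 0) (\<mu> * u, \<mu> * v) =
      (\<mu> * (u * of_int (B$1$1) - v * of_int (B$2$1)), \<mu> * (v * of_int (B$2$2) - u * of_int (B$1$2)))"
    by (simp add: algebra_simps)
  then have act: "leaf_act \<beta>2 \<beta>3 (B, 0, 0, 0, 0) (\<mu> * u, \<mu> * v) = (0, \<mu> * (real_of_int d / real N))"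
    unfolding B1 B2 by simp
  have normal: "torelli_leaf \<beta>2 \<beta>3 (0, \<mu> * (real_of_int d / real N)) = leaf"
  proof -
    have "of_real \<beta>2 * z2 + of_real \<beta>3 * z3 = of_real (\<mu> * (real_of_int d / real N)) \<longleftrightarrow>
        of_int m2 * z2 + of_int m3 * z3 = level" for z2 z3 :: complex
    proof -
      have "of_real \<beta>2 * z2 + of_real \<beta>3 * z3 = of_real \<mu> * (of_int m2 * z2 + of_int m3 * z3)"
        "complex_of_real (\<mu> * (real_of_int d / real N)) = of_real \<mu> * level"
        by (simp_all add: algebra_simps level_def)
      then show ?thesis using \<mu> by simp
    qed
    then show ?thesis by (auto simp: leaf_def height_def)
  qed
  show ?thesis
    using M13_leaf_act[OF g, of \<beta>2 \<beta>3 "(\<mu> * u, \<mu> * v)"] unfolding act M13_leaf_def normal by (rule sym)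
qed

lemma bezout_surj: "\<exists>x y. m2 * x + m3 * y = n"
proof (intro exI)
  have "m2 * (c2 * n) + m3 * (c3 * n) = (m2 * c2 + m3 * c3) * n" by (simp add: algebra_simps)
  then show "m2 * (c2 * n) + m3 * (c3 * n) = n" unfolding bezout by simp
qed

text \<open>As m2 and m3 are coprime, translations shift each entry of the parameter by an arbitrary
  multiple of \<open>\<mu>\<close>. So a matrix lifts to the stabilizer exactly when it moves the
  row (u, -v) by an integral vector, whose entries are \<open>?X\<close> and
  \<open>?Y\<close>.\<close>

lemma S_group_iff:
  "A \<in> S_group \<beta>2 \<beta>3 (\<mu> * u, \<mu> * v) \<longleftrightarrow> A \<in> carrier SL2Z \<and>
    u * of_int (A$1$1) - v * of_int (A$2$1) - u \<in> \<int> \<and> u * of_int (A$1$2) - v * of_int (A$2$2) + v \<in> \<int>"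
    (is "_ \<longleftrightarrow> _ \<and> ?X \<in> \<int> \<and> ?Y \<in> \<int>")
proof -
  have fixed: "leaf_act \<beta>2 \<beta>3 (A, k2, l2, k3, l3) (\<mu> * u, \<mu> * v) = (\<mu> * u, \<mu> * v) \<longleftrightarrow>
      ?X = of_int (- (m2 * l2 + m3 * l3)) \<and> ?Y = of_int (- (m2 * k2 + m3 * k3))" for k2 l2 k3 l3
  proof -
    have "leaf_act \<beta>2 \<beta>3 (A, k2, l2, k3, l3) (\<mu> * u, \<mu> * v) =
      (\<mu> * (u + (?X + of_int (m2 * l2 + m3 * l3))), \<mu> * (v - (?Y + of_int (m2 * k2 + m3 * k3))))"
      by (simp add: algebra_simps)
    then show ?thesis using \<mu> by auto
  qed
  have int: "(\<exists>x y. X = real_of_int (- (m2 * x + m3 * y))) \<longleftrightarrow> X \<in> \<int>" for X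
  proof
    assume "X \<in> \<int>"
    then obtain n where "X = of_int n" by (auto elim: Ints_cases)
    then show "\<exists>x y. X = real_of_int (- (m2 * x + m3 * y))" using bezout_surj[of "- n"] by (metis minus_minus)
  qed auto
  have "A \<in> S_group \<beta>2 \<beta>3 (\<mu> * u, \<mu> * v) \<longleftrightarrow> A \<in> carrier SL2Z \<and>
      (\<exists>k2 l2 k3 l3. leaf_act \<beta>2 \<beta>3 (A, k2, l2, k3, l3) (\<mu> * u, \<mu> * v) = (\<mu> * u, \<mu> * v))"
    by (force simp: S_group_def leaf_stabilizer_def torelli_group_def image_iff simp del: leaf_act.simps)
  also have "\<dots> \<longleftrightarrow> A \<in> carrier SL2Z \<and> (\<exists>l2 l3. ?X = of_int (- (m2 * l2 + m3 * l3))) \<and>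
      (\<exists>k2 k3. ?Y = of_int (- (m2 * k2 + m3 * k3)))"
    unfolding fixed by blast
  finally show ?thesis unfolding int .
qed

text \<open>Let t = d / N and C = inv2 B A B. From (u, -v) B = (0, -t) one gets (X, Y) B = (u, -v)
  (A - 1) B = (0, -t) (C - 1), which involves only the bottom row of C. Multiplication by the
  unimodular B preserves integrality.\<close>

lemma S_group_conj_iff:
  assumes A: "A \<in> carrier SL2Z"
  shows "A \<in> S_group \<beta>2 \<beta>3 (\<mu> * u, \<mu> * v) \<longleftrightarrow> inv2 B ** A ** B \<in> Gamma1 N"
proof -
  define C where "C = inv2 B ** A ** B"
  have C: "C \<in> carrier SL2Z" using A B by (simp add: C_def)
  have "B ** C = (B ** inv2 B) ** A ** B" by (simp add: C_def matrix_mul_assoc)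
  then have BC: "A ** B = B ** C" using B by simp
  let ?t = "real_of_int d / real N"
  let ?X = "u * of_int (A$1$1) - v * of_int (A$2$1) - u" and ?Y = "u * of_int (A$1$2) - v * of_int (A$2$2) + v"
  let ?X' = "?X * of_int (B$1$1) + ?Y * of_int (B$2$1)" and ?Y' = "?X * of_int (B$1$2) + ?Y * of_int (B$2$2)"
  have e: "of_int (A$i$1) * of_int (B$1$j) + of_int (A$i$2) * of_int (B$2$j) =
      (of_int (B$i$1) * of_int (C$1$j) + of_int (B$i$2) * of_int (C$2$j) :: real)" for i j :: 2
    using arg_cong[OF BC, of "\<lambda>M. real_of_int (M$i$j)"] by (simp add: matrix_mult_2_sel)
  have expand: "?X * x + ?Y * y = u * (of_int (A$1$1) * x + of_int (A$1$2) * y)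
      - v * (of_int (A$2$1) * x + of_int (A$2$2) * y) - (u * x - v * y)" for x y
    by (simp add: algebra_simps)
  have collect: "u * (of_int (B$1$1) * x + of_int (B$1$2) * y) - v * (of_int (B$2$1) * x + of_int (B$2$2) * y) =
      (u * of_int (B$1$1) - v * of_int (B$2$1)) * x - (v * of_int (B$2$2) - u * of_int (B$1$2)) * y" for x y
    by (simp add: algebra_simps)
  have X': "?X' = - (?t * of_int (C$2$1))" unfolding expand e collect B1 B2 by simp
  have "?Y' = - (?t * of_int (C$2$2)) - (u * of_int (B$1$2) - v * of_int (B$2$2))"
    unfolding expand e collect B1 B2 by simp
  then have Y': "?Y' = - (?t * of_int (C$2$2 - 1))" using B2 by (simp add: algebra_simps)
  have "real_of_int (B$1$1) * of_int (B$2$2) - of_int (B$1$2) * of_int (B$2$1) = 1"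
    using B by (simp add: SL2Z_iff flip: of_int_mult of_int_diff)
  then have "?X = (real_of_int (B$1$1) * of_int (B$2$2) - of_int (B$1$2) * of_int (B$2$1)) * ?X"
    "?Y = (real_of_int (B$1$1) * of_int (B$2$2) - of_int (B$1$2) * of_int (B$2$1)) * ?Y" by simp_all
  then have inv: "?X = ?X' * of_int (B$2$2) - ?Y' * of_int (B$2$1)" "?Y = ?Y' * of_int (B$1$1) - ?X' * of_int (B$1$2)"
    by (simp_all add: algebra_simps)
  have lin: "x * of_int k + y * of_int l \<in> \<int>" and lin': "x * of_int k - y * of_int l \<in> \<int>"
    if "x \<in> \<int>" "y \<in> \<int>" for x y :: real and k l :: int
    using that by simp_all
  have "?X \<in> \<int> \<and> ?Y \<in> \<int> \<longleftrightarrow> ?X' \<in> \<int> \<and> ?Y' \<in> \<int>"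
  proof
    assume "?X \<in> \<int> \<and> ?Y \<in> \<int>"
    then show "?X' \<in> \<int> \<and> ?Y' \<in> \<int>" using lin by blast
  next
    assume "?X' \<in> \<int> \<and> ?Y' \<in> \<int>"
    then have "?X' * of_int (B$2$2) - ?Y' * of_int (B$2$1) \<in> \<int>" "?Y' * of_int (B$1$1) - ?X' * of_int (B$1$2) \<in> \<int>"
      using lin' by blast+
    then show "?X \<in> \<int> \<and> ?Y \<in> \<int>" unfolding inv[symmetric] by blast
  qed
  also have "\<dots> \<longleftrightarrow> int N dvd C$2$1 \<and> int N dvd C$2$2 - 1"
    unfolding X' Y' minus_in_Ints_iff fraction_mult_Ints_iff[OF N coprime_d] ..
  also have "\<dots> \<longleftrightarrow> C \<in> Gamma1 N" using C by (simp add: Gamma1_iff)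
  finally show ?thesis using A by (simp add: S_group_iff C_def)
qed

lemma S_group_iso: "SL2Z\<lparr>carrier := S_group \<beta>2 \<beta>3 (\<mu> * u, \<mu> * v)\<rparr> \<cong> SL2Z\<lparr>carrier := Gamma1 N\<rparr>"
proof -
  let ?S = "S_group \<beta>2 \<beta>3 (\<mu> * u, \<mu> * v)" and ?f = "\<lambda>A. inv2 B ** A ** B"
  have S: "A \<in> carrier SL2Z" if "A \<in> ?S" for A using that S_group_iff by blast
  have cancel: "B ** ?f A ** inv2 B = A" "?f (B ** A ** inv2 B) = A" for A
  proof -
    have "B ** ?f A ** inv2 B = (B ** inv2 B) ** A ** (B ** inv2 B)" by (simp only: matrix_mul_assoc)
    then show "B ** ?f A ** inv2 B = A" using B by simp
    have "?f (B ** A ** inv2 B) = (inv2 B ** B) ** A ** (inv2 B ** B)" by (simp only: matrix_mul_assoc)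
    then show "?f (B ** A ** inv2 B) = A" using B by simp
  qed
  have "bij_betw ?f ?S (Gamma1 N)"
  proof (rule bij_betwI[where g = "\<lambda>A. B ** A ** inv2 B"])
    show "?f \<in> ?S \<rightarrow> Gamma1 N" using S_group_conj_iff S by blast
    show "(\<lambda>A. B ** A ** inv2 B) \<in> Gamma1 N \<rightarrow> ?S"
    proof
      fix A assume A: "A \<in> Gamma1 N"
      then have "B ** A ** inv2 B \<in> carrier SL2Z" using B Gamma1_SL2Z by simp
      then show "B ** A ** inv2 B \<in> ?S" using S_group_conj_iff A cancel(2) by simp
    qed
  qed (simp_all add: cancel)
  moreover have "?f (A ** A') = ?f A ** ?f A'" for A A'
  proof -
    have "?f A ** ?f A' = inv2 B ** A ** (B ** inv2 B) ** A' ** B" by (simp only: matrix_mul_assoc)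
    then show ?thesis using B by (simp add: matrix_mul_assoc)
  qed
  ultimately have "?f \<in> iso (SL2Z\<lparr>carrier := ?S\<rparr>) (SL2Z\<lparr>carrier := Gamma1 N\<rparr>)"
    by (auto simp: iso_def hom_def SL2Z_def bij_betw_def)
  then show ?thesis by (auto simp: is_iso_def)
qed

end

theorem theorem1p5:
  fixes \<alpha>1 \<alpha>2 \<alpha>3 :: real and a :: "real \<times> real"
  assumes "\<alpha>1 + \<alpha>2 + \<alpha>3 = 0"
    and "0 < \<alpha>1" "\<alpha>1 < 1"
    and "-1 < \<alpha>2" "\<alpha>2 < 0"
    and "-1 < \<alpha>3" "\<alpha>3 < 0"
    and "algebraic_in_M13 (M13_leaf \<alpha>2 \<alpha>3 a)"
  shows "\<exists>N::nat. N \<ge> 1 \<and>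
    SL2Z\<lparr>carrier := S_group \<alpha>2 \<alpha>3 a\<rparr> \<cong> SL2Z\<lparr>carrier := Gamma1 N\<rparr> \<and>
    (\<exists>\<T>. finite \<T> \<and> (\<forall>C\<in>\<T>. torsion_multisection N C) \<and>
       cspace_isomorphic
         (subcspace M13 (M13_leaf \<alpha>2 \<alpha>3 a))
         (subcspace (elliptic_modular_surface N)
            (topspace (underlying (elliptic_modular_surface N)) - \<Union>\<T>)))"
proof -
  obtain a0 a1 where a: "a = (a0, a1)" by (cases a)
  have nz: "\<alpha>2 \<noteq> 0" "\<alpha>3 \<noteq> 0" "\<alpha>2 + \<alpha>3 \<noteq> 0" using assms by auto
  note rat = algebraic_leaf_rational[OF assms(8)[unfolded a] nz]
  obtain m2 m3 :: int where m: "m3 > 0" "coprime m2 m3" "\<alpha>2 / \<alpha>3 = of_int m2 / of_int m3"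
    using rat(1) by (rule Rats_cases')
  \<comment> \<open>The two weights have the same sign, so m2 and m3 are both positive and m2 + m3
    cannot vanish.\<close>
  have "\<alpha>2 / \<alpha>3 > 0" using assms by (simp add: divide_neg_neg)
  then have m2: "m2 > 0" using m by (simp add: zero_less_divide_iff)
  obtain c2 c3 where "c2 * m2 + c3 * m3 = gcd m2 m3" using bezout_int by blast
  then have c: "m2 * c2 + m3 * c3 = 1" using m(2) by (simp add: mult.commute)
  define \<mu> where "\<mu> = \<alpha>3 / of_int m3"
  have \<mu>_nz: "\<mu> \<noteq> 0" and \<alpha>3: "\<alpha>3 = \<mu> * of_int m3" using nz m by (simp_all add: \<mu>_def)
  have "\<alpha>2 = \<alpha>2 / \<alpha>3 * \<alpha>3" using nz by simp
  also have "\<dots> = \<mu> * of_int m2" unfolding m(3) by (simp add: \<mu>_def)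
  finally have \<alpha>2: "\<alpha>2 = \<mu> * of_int m2" .
  have r: "a0 / \<mu> = of_int m3 * (a0 / \<alpha>3)" "a1 / \<mu> = of_int m3 * (a1 / \<alpha>3)" by (simp_all add: \<mu>_def)
  have "a0 / \<mu> \<in> \<rat>" "a1 / \<mu> \<in> \<rat>" unfolding r by (intro Rats_mult Rats_of_int rat)+
  then obtain B d and N :: nat where B: "B \<in> carrier SL2Z" "N \<ge> 1" "coprime d (int N)"
    "a0 / \<mu> * of_int (B$1$1) - a1 / \<mu> * of_int (B$2$1) = 0"
    "a1 / \<mu> * of_int (B$2$2) - a0 / \<mu> * of_int (B$1$2) = real_of_int d / real N"
    by (rule rational_row_normal_form)
  interpret rational_leaf m2 m3 c2 c3 d N \<mu> "a0 / \<mu>" "a1 / \<mu>" B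
    using B c \<mu>_nz m(1) m2 by unfold_locales auto
  have a_eq: "a = (\<mu> * (a0 / \<mu>), \<mu> * (a1 / \<mu>))" using \<mu>_nz by (simp add: a)
  have leaf: "M13_leaf \<alpha>2 \<alpha>3 a = to_M13 ` leaf"
    using M13_leaf_eq unfolding \<alpha>2 \<alpha>3 a_eq .
  have iso: "SL2Z\<lparr>carrier := S_group \<alpha>2 \<alpha>3 a\<rparr> \<cong> SL2Z\<lparr>carrier := Gamma1 N\<rparr>"
    using S_group_iso unfolding \<alpha>2 \<alpha>3 a_eq .
  obtain \<T> where \<T>: "finite \<T>" "\<forall>C\<in>\<T>. torsion_multisection N C"
    "jorbit ` dom = topspace (underlying (elliptic_modular_surface N)) - \<Union>\<T>"
    using dom_complement_torsion by blast
  have "cspace_isomorphic (subcspace M13 (M13_leaf \<alpha>2 \<alpha>3 a))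
      (subcspace (elliptic_modular_surface N) (topspace (underlying (elliptic_modular_surface N)) - \<Union>\<T>))"
    unfolding leaf \<T>(3)[symmetric] cspace_isomorphic_def using cspace_iso_leaf_iso by blast
  then show ?thesis using \<open>N \<ge> 1\<close> iso \<T>(1,2) by blast
qed

end
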